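(* For $\mathbf n=(2^k)_{k\in\mathbb N}$ there is a set $M\subseteq\mathcal M(\mathbb R/\mathbb Z)$ such that $M=M(\mathbf n\alpha)$ for generic $\alpha\in\mathbb R/\mathbb Z$; $M$ consists exactly of all measures in $\mathcal M(\mathbb R/\mathbb Z)$ which are invariant under $x\mapsto 2x$. In contrast, for $\mathbf n'=(n'_k)_{k\in\mathbb N}$ with $n'_k=2^k+1$, there is no $M'\subseteq\mathcal M(\mathbb R/\mathbb Z)$ such that $M'=M(\mathbf n'\alpha)$ for generic $\alpha\in\mathbb R/\mathbb Z$.
   Context: For $\mathbf n=(n_k)$ and $\alpha\in\mathbb R/\mathbb Z$, $\mathbf n\alpha$ denotes the sequence $(n_k\alpha)_k$ in $X=\mathbb R/\mathbb Z$. $\mathcal M(X)$ is the set of Borel probability measures on $X$ with the topology of weak convergence. For a sequence $\mathbf x=(x_n)_{n\in\mathbb N}$ in $X$ let $\mu_{\mathbf x,N}=\frac1N\sum_{n=1}^N\delta_{x_n}$ and let $M(\mathbf x)\subseteq\mathcal M(X)$ be the set of accumulation points $\bigcap_{N_0\ge1}\overline{\{\mu_{\mathbf x,N}: N\ge N_0\}}$ of the sequence $(\mu_{\mathbf x,N})_N$. A property holds for generic $\alpha$ if the set of $\alpha$ having it is residual, i.e. its complement is meager (of first Baire category). *)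

theory Defs
  imports "HOL-Probability.Probability"
begin

quotient_type circle = real / "\<lambda>x y :: real. x - y \<in> \<int>"
  morphisms rep_circle to_circle
proof (rule equivpI)
  show "symp (\<lambda>x y :: real. x - y \<in> \<int>)"
    by (rule sympI) (metis Ints_minus minus_diff_eq)
  show "transp (\<lambda>x y :: real. x - y \<in> \<int>)"
  proof (rule transpI)
    fix x y z :: real
    assume "x - y \<in> \<int>" "y - z \<in> \<int>"
    then have "(x - y) + (y - z) \<in> \<int>" by (rule Ints_add)
    then show "x - z \<in> \<int>" by simp
  qed
qed (simp add: reflp_def)

text \<open>The circle carries the quotient topology; the constant \<^const>\<open>borel\<close> at type
  \<^typ>\<open>circle measure\<close> is the Borel sigma-algebra of this topology.\<close>

instantiation circle :: topological_space
begin

definition open_circle :: "circle set \<Rightarrow> bool" where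
  "open_circle U \<longleftrightarrow> open (to_circle -` U)"

instance
  by standard (auto simp: open_circle_def vimage_Union)

end

lift_definition mult_circle :: "nat \<Rightarrow> circle \<Rightarrow> circle" is "\<lambda>n x. real n * x"
  by (metis Ints_mult Ints_of_nat right_diff_distrib)

definition mult_seq :: "(nat \<Rightarrow> nat) \<Rightarrow> circle \<Rightarrow> nat \<Rightarrow> circle" where
  "mult_seq n \<alpha> = (\<lambda>k. mult_circle (n k) \<alpha>)"

definition borel_prob_measures :: "'a::topological_space measure set" where
  "borel_prob_measures = {\<mu>. prob_space \<mu> \<and> sets \<mu> = sets borel}"

text \<open>The initial topology on the set of Borel probability measures with respect to the maps
  \<open>\<mu> \<mapsto> \<integral>f d\<mu>\<close>, where \<open>f\<close> is bounded and continuous.\<close>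

definition weak_topology :: "'a::topological_space measure topology" where
  "weak_topology = topology_generated_by
     {{\<mu> \<in> borel_prob_measures. (\<integral>x. f x \<partial>\<mu>) \<in> U} | (f :: 'a \<Rightarrow> real) U.
        continuous_on UNIV f \<and> bounded (range f) \<and> open U}"

text \<open>Sequences are indexed from 1 on: the value \<open>x 0\<close> is not used. Only \<open>N \<ge> 1\<close> is relevant.\<close>

definition empirical_measure :: "(nat \<Rightarrow> 'a::topological_space) \<Rightarrow> nat \<Rightarrow> 'a measure" where
  "empirical_measure x N =
     measure_of UNIV (sets borel)
       (\<lambda>A. ennreal (1 / real N) * (\<Sum>n = 1..N. emeasure (return borel (x n)) A))"

definition limit_measures :: "(nat \<Rightarrow> 'a::topological_space) \<Rightarrow> 'a measure set" where
  "limit_measures x =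
     (\<Inter>N0 \<in> {1..}. weak_topology closure_of {empirical_measure x N | N. N \<ge> N0})"

definition nowhere_dense :: "'a::topological_space set \<Rightarrow> bool" where
  "nowhere_dense A \<longleftrightarrow> interior (closure A) = {}"

definition meager :: "'a::topological_space set \<Rightarrow> bool" where
  "meager S \<longleftrightarrow> (\<exists>\<F>. countable \<F> \<and> (\<forall>A \<in> \<F>. nowhere_dense A) \<and> S = \<Union>\<F>)"

definition residual :: "'a::topological_space set \<Rightarrow> bool" where
  "residual S \<longleftrightarrow> meager (- S)"

definition generic :: "('a::topological_space \<Rightarrow> bool) \<Rightarrow> bool" where
  "generic P \<longleftrightarrow> residual {\<alpha>. P \<alpha>}"

definition invariant_under :: "('a::topological_space \<Rightarrow> 'a) \<Rightarrow> 'a measure \<Rightarrow> bool" where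
  "invariant_under T \<mu> \<longleftrightarrow> (\<forall>A \<in> sets borel. emeasure \<mu> (T -` A) = emeasure \<mu> A)"

text \<open>\<^const>\<open>measure_of\<close> yields the zero measure when its argument is not countably additive;
  the following facts exclude this case.\<close>

lemma sets_empirical_measure [simp]: "sets (empirical_measure x N) = sets borel"
  unfolding empirical_measure_def using sets.sigma_sets_eq[of borel]
  by (simp add: sets_measure_of_conv)

lemma emeasure_empirical_measure:
  assumes "A \<in> sets borel"
  shows "emeasure (empirical_measure x N) A =
    ennreal (1 / real N) * (\<Sum>n = 1..N. indicator A (x n))"
proof -
  let ?m = "\<lambda>A. ennreal (1 / real N) * (\<Sum>n = 1..N. emeasure (return borel (x n)) A)"
  have "countably_additive (sets borel) ?m"
  proof (rule countably_additiveI)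
    fix F :: "nat \<Rightarrow> 'a set"
    assume F: "range F \<subseteq> sets borel" "disjoint_family F" "\<Union> (range F) \<in> sets borel"
    have "(\<Sum>i. ?m (F i)) =
        ennreal (1 / real N) * (\<Sum>n = 1..N. \<Sum>i. emeasure (return borel (x n)) (F i))"
      by (simp add: ennreal_suminf_cmult suminf_sum)
    also have "\<dots> = ?m (\<Union> (range F))"
      using F by (simp add: suminf_emeasure del: emeasure_return)
    finally show "(\<Sum>i. ?m (F i)) = ?m (\<Union> (range F))" .
  qed
  moreover have "positive (sets borel) ?m"
    by (simp add: positive_def)
  ultimately have "emeasure (empirical_measure x N) A = ?m A"
    by (intro emeasure_measure_of[OF empirical_measure_def])
       (use assms in \<open>auto simp del: emeasure_return\<close>)
  with assms show ?thesis by simp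
qed

end

theory Submission
  imports Defs
begin

text \<open>Write \<open>T x = 2 x\<close>. The averages of \<open>f \<circ> T\<close> and \<open>f\<close> along an orbit of \<open>T\<close> differ by \<open>O(1/N)\<close>, so
  every limit measure of \<open>(2 ^ k \<alpha>)\<close> is invariant. Conversely, an invariant \<open>\<mu>\<close> is the average of the
  empirical measures of orbit blocks of any length \<open>L\<close>, hence it is close to the mean of finitely many
  such blocks; concatenating their binary digits gives a rational point whose orbit is periodic
  and distributed almost like \<open>\<mu>\<close>. Every translate of a rational \<open>z\<close> by a dyadic rational eventually has
  the orbit of \<open>z\<close>, so by Baire category the generic \<open>\<alpha>\<close> shadows each of the countably many rational
  orbits for arbitrarily long times, and every invariant measure is a limit measure.

  The sequence \<open>((2 ^ k + 1) \<alpha>)\<close> is the translate of \<open>(2 ^ k \<alpha>)\<close> by \<open>\<alpha>\<close>. For generic \<open>\<alpha>\<close> its limit measures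
  therefore are the translates by \<open>\<alpha>\<close> of the invariant measures, and \<open>\<alpha>\<close> is recovered from them: as \<open>0\<close> is
  the only fixed point of \<open>T\<close>, the only Dirac measure among them is the one at \<open>\<alpha>\<close>.\<close>

section \<open>Bounded continuous functions\<close>

lemma bcontfun_cont: "f \<in> bcontfun \<Longrightarrow> continuous_on UNIV f"
  and bcontfun_bounded: "f \<in> bcontfun \<Longrightarrow> bounded (range f)"
  by (auto simp: bcontfun_def)

lemma bcontfun_measurable:
  fixes f :: "'a::topological_space \<Rightarrow> real"
  shows "f \<in> bcontfun \<Longrightarrow> f \<in> borel_measurable borel"
  by (simp add: bcontfun_cont borel_measurable_continuous_onI)

lemma bcontfun_compose:
  assumes "f \<in> bcontfun" "continuous_on UNIV T"
  shows "(\<lambda>x. f (T x)) \<in> bcontfun"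
proof -
  have "range (\<lambda>x. f (T x)) \<subseteq> range f" by auto
  then show ?thesis
    using assms bounded_subset continuous_on_compose2[of UNIV f UNIV T]
    by (auto simp: bcontfun_def)
qed

lemma bcontfun_finite_bound:
  fixes F :: "('a::topological_space \<Rightarrow> real) set"
  assumes "finite F" "F \<subseteq> bcontfun"
  shows "\<exists>B\<ge>0. \<forall>f\<in>F. \<forall>x. \<bar>f x\<bar> \<le> B"
proof -
  have "bounded (\<Union>f\<in>F. range f)"
    using assms bcontfun_bounded by (intro bounded_UN) auto
  then obtain B where B: "\<forall>y\<in>(\<Union>f\<in>F. range f). norm y \<le> B" unfolding bounded_iff ..
  have "\<bar>f x\<bar> \<le> \<bar>B\<bar>" if "f \<in> F" for f x
  proof -
    have "f x \<in> (\<Union>f\<in>F. range f)" using that by blast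
    with B have "norm (f x) \<le> B" by blast
    then show ?thesis by simp
  qed
  then show ?thesis by (intro exI[of _ "\<bar>B\<bar>"]) simp
qed

section \<open>The circle\<close>

lemma to_circle_eq_iff: "to_circle x = to_circle y \<longleftrightarrow> x - y \<in> \<int>"
  by (rule circle.abs_eq_iff)

lemma to_circle_surj: "\<exists>x. c = to_circle x"
  by (metis Quotient3_abs_rep Quotient3_circle)

lemma to_circle_add_of_int [simp]: "to_circle (x + of_int k) = to_circle x"
  by (simp add: to_circle_eq_iff)

lemma mult_circle_to_circle [simp]: "mult_circle n (to_circle x) = to_circle (real n * x)"
  by (rule mult_circle.abs_eq)

lemma continuous_to_circle: "continuous_on UNIV to_circle"
  by (subst continuous_on_open_vimage) (auto simp: open_circle_def)

text \<open>The universal property of the quotient topology; it reduces continuity on the circle to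
  calculus on the line.\<close>

lemma continuous_on_circle_iff:
  "continuous_on UNIV f \<longleftrightarrow> continuous_on UNIV (\<lambda>x. f (to_circle x))"
  by (simp add: continuous_on_open_vimage open_circle_def vimage_def)

text \<open>The full preimage of the image is the union of the integer translates of
  \<open>U\<close>, so the quotient map is open. This later carries balls and interiors from the
  line to the circle.\<close>

lemma open_to_circle_image:
  assumes "open U"
  shows "open (to_circle ` U)"
proof -
  have "to_circle -` to_circle ` U = (\<Union>k::int. (\<lambda>x. x + of_int k) ` U)"
  proof (intro equalityI subsetI)
    fix x assume "x \<in> to_circle -` to_circle ` U"
    then obtain u where u: "u \<in> U" "x - u \<in> \<int>" by (auto simp: to_circle_eq_iff)
    then obtain k :: int where "x - u = of_int k" by (auto elim: Ints_cases)
    then have "x = u + of_int k" by simp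
    with u show "x \<in> (\<Union>k::int. (\<lambda>x. x + of_int k) ` U)" by blast
  next
    fix x assume "x \<in> (\<Union>k::int. (\<lambda>x. x + of_int k) ` U)"
    then obtain u k where "u \<in> U" "x = u + of_int k" by blast
    then show "x \<in> to_circle -` to_circle ` U" by simp
  qed
  moreover have "open ((\<lambda>x. x + real_of_int k) ` U)" for k
    using open_translation[OF assms, of "of_int k"] by (simp add: add.commute)
  ultimately show ?thesis by (simp add: open_circle_def open_UN)
qed

lemma continuous_mult_circle: "continuous_on UNIV (mult_circle n)"
proof -
  have "continuous_on UNIV (\<lambda>x. to_circle (real n * x))"
    by (rule continuous_on_compose2[OF continuous_to_circle]) (auto intro!: continuous_intros)
  then show ?thesis by (subst continuous_on_circle_iff) simp
qed

lemma mult_circle_mult: "mult_circle m (mult_circle n c) = mult_circle (m * n) c"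
  using to_circle_surj[of c] by (auto simp: mult.assoc)

lift_definition add_circle :: "circle \<Rightarrow> circle \<Rightarrow> circle" is "(+)"
  by (metis Ints_add add_diff_add)

lemma add_circle_to_circle [simp]: "add_circle (to_circle x) (to_circle y) = to_circle (x + y)"
  by (rule add_circle.abs_eq)

lemma continuous_add_circle: "continuous_on UNIV (add_circle c)"
proof -
  obtain a where "c = to_circle a" using to_circle_surj by blast
  moreover have "continuous_on UNIV (\<lambda>x. to_circle (a + x))"
    by (rule continuous_on_compose2[OF continuous_to_circle]) (auto intro!: continuous_intros)
  ultimately show ?thesis by (subst continuous_on_circle_iff) simp
qed

text \<open>Uniform continuity covers nearby points, boundedness covers distant ones once
  \<open>C\<close> is large. The affine bound holds for all \<open>x\<close> and \<open>y\<close>,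
  so it can be summed along an orbit without distinguishing cases.\<close>

lemma continuous_modulus_circle:
  fixes f :: "circle \<Rightarrow> real"
  assumes "f \<in> bcontfun" "\<eta> > 0"
  shows "\<exists>C\<ge>0. \<forall>x y. \<bar>f (to_circle x) - f (to_circle y)\<bar> \<le> \<eta> + C * \<bar>x - y\<bar>"
proof -
  note f = bcontfun_cont[OF assms(1)] bcontfun_bounded[OF assms(1)]
  let ?g = "\<lambda>x. f (to_circle x)"
  have "continuous_on {-1..2} ?g"
    using f continuous_on_circle_iff continuous_on_subset by blast
  then have "uniformly_continuous_on {-1..2} ?g"
    by (rule compact_uniformly_continuous) simp
  then obtain d where d: "d > 0"
    "\<And>x y. x \<in> {-1..2} \<Longrightarrow> y \<in> {-1..2} \<Longrightarrow> dist y x < d \<Longrightarrow> dist (?g y) (?g x) < \<eta>"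
    using assms(2) unfolding uniformly_continuous_on_def by meson
  obtain B where B: "\<And>c. \<bar>f c\<bar> \<le> B"
    using f(2) by (auto simp: bounded_iff)
  have B0: "B \<ge> 0" using B[of undefined] by linarith
  define e where "e = min d 1"
  have e: "e > 0" "e \<le> d" "e \<le> 1" using d by (auto simp: e_def)
  have "\<bar>?g x - ?g y\<bar> \<le> \<eta> + (2 * B / e) * \<bar>x - y\<bar>" for x y
  proof (cases "\<bar>x - y\<bar> < e")
    case True
    \<comment> \<open>Subtracting one integer from both points puts \<open>u\<close> into [0, 1); as
      \<open>e \<le> 1\<close>, \<open>v\<close> then lies in [-1, 2], where uniform continuity is
      available.\<close>
    define u v where "u = x + of_int (- \<lfloor>x\<rfloor>)" and "v = y + of_int (- \<lfloor>x\<rfloor>)"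
    have uv: "?g u = ?g x" "?g v = ?g y" "u - v = x - y"
      unfolding u_def v_def by (simp only: to_circle_add_of_int, simp only: to_circle_add_of_int, simp)
    have "0 \<le> u" "u < 1" unfolding u_def by linarith+
    then have "\<bar>?g u - ?g v\<bar> < \<eta>"
      using d(2)[of v u] True uv(3) e unfolding dist_real_def atLeastAtMost_iff by linarith
    moreover have "(2 * B / e) * \<bar>x - y\<bar> \<ge> 0" using B0 e by simp
    ultimately show ?thesis using uv by simp
  next
    case False
    then have "2 * B \<le> (2 * B / e) * \<bar>x - y\<bar>"
      using e B0 by (simp add: divide_simps mult_left_mono)
    moreover have "\<bar>?g x - ?g y\<bar> \<le> 2 * B" using B[of "to_circle x"] B[of "to_circle y"] by linarith
    ultimately show ?thesis using assms(2) by linarith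
  qed
  moreover have "2 * B / e \<ge> 0" using B0 e by simp
  ultimately show ?thesis by blast
qed

lemma continuous_modulus_circle_finite:
  fixes F :: "(circle \<Rightarrow> real) set"
  assumes "finite F" "F \<subseteq> bcontfun" "\<eta> > 0"
  shows "\<exists>C\<ge>0. \<forall>f\<in>F. \<forall>x y. \<bar>f (to_circle x) - f (to_circle y)\<bar> \<le> \<eta> + C * \<bar>x - y\<bar>"
  using assms(1,2)
proof (induction F rule: finite_induct)
  case (insert f F)
  from insert obtain C where C: "C \<ge> 0"
    "\<And>g x y. g \<in> F \<Longrightarrow> \<bar>g (to_circle x) - g (to_circle y)\<bar> \<le> \<eta> + C * \<bar>x - y\<bar>" by auto
  obtain D where D: "D \<ge> 0"
    "\<And>x y. \<bar>f (to_circle x) - f (to_circle y)\<bar> \<le> \<eta> + D * \<bar>x - y\<bar>"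
    using continuous_modulus_circle[of f \<eta>] insert assms(3) by auto
  have le: "\<eta> + C * \<bar>x - y\<bar> \<le> \<eta> + (C + D) * \<bar>x - y\<bar>"
    "\<eta> + D * \<bar>x - y\<bar> \<le> \<eta> + (C + D) * \<bar>x - y\<bar>" for x y
    using C(1) D(1) by (simp_all add: mult_right_mono)
  show ?case
  proof (intro exI[of _ "C + D"] conjI ballI allI)
    fix g x y assume "g \<in> insert f F"
    then show "\<bar>g (to_circle x) - g (to_circle y)\<bar> \<le> \<eta> + (C + D) * \<bar>x - y\<bar>"
      using C(2) D(2) le order_trans by (metis insertE)
  qed (use C D in simp)
qed auto

section \<open>Weak limits of empirical measures\<close>

lemma integral_empirical_measure:
  fixes f :: "'a::topological_space \<Rightarrow> real"
  assumes "N \<ge> 1" "f \<in> borel_measurable borel"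
  shows "(\<integral>y. f y \<partial>empirical_measure x N) = (\<Sum>n=1..N. f (x n)) / real N"
proof -
  let ?U = "uniform_count_measure {1..N}"
  have m: "x \<in> measurable ?U borel"
    by (simp add: measurable_def sets_uniform_count_measure space_uniform_count_measure)
  \<comment> \<open>As the push-forward of the uniform measure on the indices, it integrates
    \<open>f\<close> to a finite mean.\<close>
  have "empirical_measure x N = distr ?U borel x"
  proof (rule measure_eqI)
    fix A assume "A \<in> sets (empirical_measure x N)"
    then have A: "A \<in> sets borel" by simp
    have "x -` A \<inter> {1..N} = {n \<in> {1..N}. x n \<in> A}" by auto
    then have "emeasure (distr ?U borel x) A = ennreal (real (card {n \<in> {1..N}. x n \<in> A}) / real N)"
      using A m by (simp add: emeasure_distr space_uniform_count_measure emeasure_uniform_count_measure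
          del: atLeastAtMost_iff)
    moreover have "(\<Sum>n = 1..N. indicator A (x n)) = ennreal (real (card {n \<in> {1..N}. x n \<in> A}))"
    proof -
      have "{1..N} \<inter> {n. x n \<in> A} = {n \<in> {1..N}. x n \<in> A}" by auto
      then show ?thesis
        by (simp add: indicator_def sum.If_cases ennreal_of_nat_eq_real_of_nat del: atLeastAtMost_iff)
    qed
    ultimately show "emeasure (empirical_measure x N) A = emeasure (distr ?U borel x) A"
      using A by (simp add: emeasure_empirical_measure ennreal_mult[symmetric])
  qed simp
  then show ?thesis
    using m assms by (simp add: integral_distr integral_uniform_count_measure)
qed

lemma empirical_measure_in_borel_prob_measures:
  assumes "N \<ge> 1"
  shows "empirical_measure x N \<in> borel_prob_measures"
proof -
  have "space (empirical_measure x N) = UNIV"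
    using sets_eq_imp_space_eq[OF sets_empirical_measure[of x N]] by simp
  then have "emeasure (empirical_measure x N) (space (empirical_measure x N)) = 1"
    using assms by (simp add: emeasure_empirical_measure ennreal_of_nat_eq_real_of_nat
        ennreal_mult[symmetric])
  then show ?thesis
    by (auto simp: borel_prob_measures_def intro: prob_spaceI)
qed

section \<open>Neighbourhoods and limit points in the weak topology\<close>

lemma topspace_weak_topology [simp]:
  "topspace weak_topology = (borel_prob_measures :: 'a::topological_space measure set)"
proof -
  have "\<exists>(f :: 'a \<Rightarrow> real) U. borel_prob_measures = {\<mu> \<in> borel_prob_measures. (\<integral>x. f x \<partial>\<mu>) \<in> U} \<and>
      continuous_on UNIV f \<and> bounded (range f) \<and> open U"
    \<comment> \<open>The zero function with \<open>U = UNIV\<close> makes the whole set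
      subbasic.\<close>
    by (rule exI[of _ "\<lambda>_. 0"], rule exI[of _ UNIV]) (auto simp: bounded_iff)
  then show ?thesis
    unfolding weak_topology_def topology_generated_by_topspace by blast
qed

text \<open>A neighbourhood base of \<open>\<mu>\<close> when \<open>F\<close> ranges over the finite subsets of \<^const>\<open>bcontfun\<close>.\<close>

definition weak_ball :: "'a::topological_space measure \<Rightarrow> ('a \<Rightarrow> real) set \<Rightarrow> real \<Rightarrow> 'a measure set" where
  "weak_ball \<mu> F \<epsilon> =
    {\<nu> \<in> borel_prob_measures. \<forall>f\<in>F. \<bar>(\<integral>x. f x \<partial>\<nu>) - (\<integral>x. f x \<partial>\<mu>)\<bar> < \<epsilon>}"

lemma weak_ball_Un: "weak_ball \<mu> (F \<union> G) (min \<epsilon> \<delta>) \<subseteq> weak_ball \<mu> F \<epsilon> \<inter> weak_ball \<mu> G \<delta>"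
  by (auto simp: weak_ball_def)

text \<open>Induction over the generation of the topology: a subbasic set contributes one function
  and the radius of an interval inside \<open>U\<close>; an intersection takes the union of the
  function sets and the smaller radius.\<close>

lemma weak_neighbourhood:
  fixes \<mu> :: "'a::topological_space measure"
  assumes "openin weak_topology V" "\<mu> \<in> V"
  shows "\<exists>F \<epsilon>. finite F \<and> F \<subseteq> bcontfun \<and> \<epsilon> > 0 \<and> weak_ball \<mu> F \<epsilon> \<subseteq> V"
proof -
  from assms(1) have "generate_topology_on
     {{\<mu> \<in> borel_prob_measures. (\<integral>x. f x \<partial>\<mu>) \<in> U} | (f :: 'a \<Rightarrow> real) U.
        continuous_on UNIV f \<and> bounded (range f) \<and> open U} V"
    unfolding weak_topology_def by (rule openin_topology_generated_by)
  then show ?thesis using assms(2)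
  proof induction
    case (Int a b)
    from Int.IH(1)[OF IntD1[OF Int.prems]] obtain F \<epsilon> where
      F: "finite F" "F \<subseteq> bcontfun" "\<epsilon> > 0" "weak_ball \<mu> F \<epsilon> \<subseteq> a" by auto
    from Int.IH(2)[OF IntD2[OF Int.prems]] obtain G \<delta> where
      G: "finite G" "G \<subseteq> bcontfun" "\<delta> > 0" "weak_ball \<mu> G \<delta> \<subseteq> b" by auto
    have "weak_ball \<mu> (F \<union> G) (min \<epsilon> \<delta>) \<subseteq> a \<inter> b"
      using weak_ball_Un F(4) G(4) by blast
    with F G show ?case
      by (intro exI[of _ "F \<union> G"] exI[of _ "min \<epsilon> \<delta>"]) simp
  next
    case (UN K)
    then obtain k where k: "k \<in> K" "\<mu> \<in> k" by blast
    from UN.IH[OF this] obtain F \<epsilon> where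
      F: "finite F" "F \<subseteq> bcontfun" "\<epsilon> > 0" "weak_ball \<mu> F \<epsilon> \<subseteq> k" by auto
    with k(1) have "weak_ball \<mu> F \<epsilon> \<subseteq> \<Union>K" by blast
    with F show ?case by blast
  next
    case (Basis s)
    then obtain f :: "'a \<Rightarrow> real" and U where
      s: "s = {\<mu> \<in> borel_prob_measures. (\<integral>x. f x \<partial>\<mu>) \<in> U}" and
      f: "f \<in> bcontfun" and U: "open U" by (auto simp: bcontfun_def)
    then have "(\<integral>x. f x \<partial>\<mu>) \<in> U" using Basis.prems by simp
    then obtain e where e: "e > 0" "\<forall>y. dist y (\<integral>x. f x \<partial>\<mu>) < e \<longrightarrow> y \<in> U"
      using U by (auto simp: open_dist)
    then have "weak_ball \<mu> {f} e \<subseteq> s"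
      unfolding weak_ball_def s dist_real_def by auto
    with e f show ?case
      by (intro exI[of _ "{f}"] exI[of _ e]) simp
  qed simp
qed

text \<open>Replaces the weak topology by averages of finitely many test functions; later arguments
  about limit measures go through this criterion. \<open>N \<ge> 1\<close> is listed separately
  because \<open>N0\<close> may be 0.\<close>

lemma limit_measures_iff:
  fixes x :: "nat \<Rightarrow> 'a::topological_space"
  shows "\<mu> \<in> limit_measures x \<longleftrightarrow> \<mu> \<in> borel_prob_measures \<and>
    (\<forall>F (\<epsilon>::real) N0. finite F \<longrightarrow> F \<subseteq> bcontfun \<longrightarrow> \<epsilon> > 0 \<longrightarrow>
      (\<exists>N\<ge>N0. N \<ge> 1 \<and> (\<forall>f\<in>F. \<bar>(\<Sum>n=1..N. f (x n)) / real N - (\<integral>y. f y \<partial>\<mu>)\<bar> < \<epsilon>)))"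
    (is "_ \<longleftrightarrow> _ \<and> ?R")
proof (intro iffI conjI allI impI)
  assume \<mu>: "\<mu> \<in> limit_measures x"
  have "\<mu> \<in> weak_topology closure_of {empirical_measure x N | N. N \<ge> 1}"
    using \<mu> unfolding limit_measures_def by blast
  then show pm: "\<mu> \<in> borel_prob_measures"
    using closure_of_subset_topspace by fastforce
  fix F :: "('a \<Rightarrow> real) set" and \<epsilon> :: real and N0 :: nat
  assume F: "finite F" "F \<subseteq> bcontfun" and \<epsilon>: "\<epsilon> > 0"
  define W where "W f = {\<nu> \<in> borel_prob_measures. (\<integral>y. f y \<partial>\<nu>) \<in> ball (\<integral>y. f y \<partial>\<mu>) \<epsilon>}"
    for f :: "'a \<Rightarrow> real"
  \<comment> \<open>Adding the whole space keeps the intersected family nonempty when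
    \<open>F\<close> is empty.\<close>
  define V where "V = \<Inter> (insert borel_prob_measures (W ` F))"
  have "openin weak_topology (W f)" if "f \<in> F" for f
  proof -
    have "continuous_on UNIV f" "bounded (range f)" using F that by (auto simp: bcontfun_def)
    then show ?thesis
      unfolding weak_topology_def W_def by (intro topology_generated_by_Basis) blast
  qed
  then have "openin weak_topology V"
    unfolding V_def using F openin_topspace[of weak_topology]
    by (intro openin_Inter) (auto simp del: openin_topspace)
  moreover have "\<mu> \<in> V" using pm \<epsilon> by (auto simp: V_def W_def)
  moreover have "\<mu> \<in> weak_topology closure_of {empirical_measure x N | N. N \<ge> max N0 1}"
    using \<mu> unfolding limit_measures_def by (rule INT_D) simp
  ultimately obtain N where N: "N \<ge> max N0 1" "empirical_measure x N \<in> V"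
    unfolding in_closure_of by blast
  have "\<bar>(\<Sum>n=1..N. f (x n)) / real N - (\<integral>y. f y \<partial>\<mu>)\<bar> < \<epsilon>" if f: "f \<in> F" for f
  proof -
    have "empirical_measure x N \<in> W f" using N(2) f unfolding V_def by blast
    moreover have "f \<in> borel_measurable borel"
      using F f bcontfun_measurable by blast
    ultimately show ?thesis
      using N(1) integral_empirical_measure[of N f x]
      by (simp add: W_def dist_real_def abs_minus_commute)
  qed
  then show "\<exists>N\<ge>N0. N \<ge> 1 \<and> (\<forall>f\<in>F. \<bar>(\<Sum>n=1..N. f (x n)) / real N - (\<integral>y. f y \<partial>\<mu>)\<bar> < \<epsilon>)"
    using N(1) by auto
next
  assume \<mu>: "\<mu> \<in> borel_prob_measures \<and> ?R"
  have "\<mu> \<in> weak_topology closure_of {empirical_measure x N | N. N \<ge> N0}" for N0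
    unfolding in_closure_of
  proof (intro conjI allI impI)
    show "\<mu> \<in> topspace weak_topology" using \<mu> by simp
    fix T assume "\<mu> \<in> T \<and> openin weak_topology T"
    with weak_neighbourhood obtain F \<epsilon> where
      F: "finite F" "F \<subseteq> bcontfun" "\<epsilon> > 0" "weak_ball \<mu> F \<epsilon> \<subseteq> T" by metis
    obtain N where N: "N \<ge> N0" "N \<ge> 1"
      "\<forall>f\<in>F. \<bar>(\<Sum>n=1..N. f (x n)) / real N - (\<integral>y. f y \<partial>\<mu>)\<bar> < \<epsilon>"
      using \<mu> F(1-3) by blast
    have "f \<in> borel_measurable borel" if "f \<in> F" for f
      using F that bcontfun_measurable by blast
    then have "empirical_measure x N \<in> weak_ball \<mu> F \<epsilon>"
      using N by (simp add: weak_ball_def empirical_measure_in_borel_prob_measures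
          integral_empirical_measure)
    then show "\<exists>\<nu>. \<nu> \<in> {empirical_measure x N | N. N \<ge> N0} \<and> \<nu> \<in> T" using N F(4) by blast
  qed
  then show "\<mu> \<in> limit_measures x" unfolding limit_measures_def by blast
qed

lemma bcontfun_integrable:
  fixes f :: "'a::topological_space \<Rightarrow> real"
  assumes "\<mu> \<in> borel_prob_measures" "f \<in> bcontfun"
  shows "integrable \<mu> f"
proof -
  interpret prob_space \<mu> using assms(1) by (simp add: borel_prob_measures_def)
  obtain B where "\<And>x. \<bar>f x\<bar> \<le> B" using bcontfun_finite_bound[of "{f}"] assms(2) by auto
  moreover have "f \<in> borel_measurable \<mu>"
    using bcontfun_measurable[OF assms(2)] assms(1)
    by (simp add: borel_prob_measures_def cong: measurable_cong_sets)
  ultimately show ?thesis by (intro integrable_const_bound[of _ B]) auto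
qed

section \<open>Invariant measures\<close>

lemma infdist_add_of_int_le:
  fixes C :: "real set"
  assumes "closed C" "C \<noteq> {}" "\<And>x k. x \<in> C \<Longrightarrow> x + of_int k \<in> C"
  shows "infdist (x + of_int k) C \<le> infdist x C"
proof -
  obtain y where y: "y \<in> C" "infdist x C = dist x y"
    using infdist_attains_inf[OF assms(1,2)] by metis
  have "infdist (x + of_int k) C \<le> dist (x + of_int k) (y + of_int k)"
    using assms(3) y(1) by (intro infdist_le)
  with y show ?thesis by simp
qed

lemma infdist_add_of_int:
  fixes C :: "real set"
  assumes "closed C" "C \<noteq> {}" "\<And>x k. x \<in> C \<Longrightarrow> x + of_int k \<in> C"
  shows "infdist (x + of_int k) C = infdist x C"
  using infdist_add_of_int_le[OF assms, of x k]
    infdist_add_of_int_le[OF assms, of "x + of_int k" "-k"] by simp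

text \<open>With d the distance to the complement of \<open>U\<close>, the functions min(1, n d)
  increase to the indicator. The distance is measured on the line, to the preimage of the
  complement; that set is invariant under integer translations, so d descends to the circle.\<close>

lemma open_circle_approx:
  fixes U :: "circle set"
  assumes "open U"
  shows "\<exists>f :: nat \<Rightarrow> circle \<Rightarrow> real. (\<forall>n. f n \<in> bcontfun) \<and> (\<forall>n c. \<bar>f n c\<bar> \<le> 1) \<and>
    (\<forall>c. (\<lambda>n. f n c) \<longlonglongrightarrow> indicator U c)"
\<comment> \<open>If \<open>U = UNIV\<close>, the complement is empty and \<open>infdist\<close> to
  it is 0 by convention, so the construction would converge to 0 instead of 1.\<close>
proof (cases "U = UNIV")
  case True
  then show ?thesis by (intro exI[of _ "\<lambda>_ _. 1"]) (auto simp: bcontfun_def bounded_iff)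
next
  case False
  define C where "C = - (to_circle -` U)"
  have C: "closed C" using assms by (auto simp: C_def open_circle_def)
  have ne: "C \<noteq> {}"
  proof -
    obtain c where "c \<notin> U" using False by blast
    moreover obtain x where "c = to_circle x" using to_circle_surj by blast
    ultimately show ?thesis by (auto simp: C_def)
  qed
  have per: "x + of_int k \<in> C" if "x \<in> C" for x k using that by (simp add: C_def)
  define g where "g c = infdist (rep_circle c) C" for c
  have g: "g (to_circle x) = infdist x C" for x
  proof -
    have "to_circle (rep_circle (to_circle x)) = to_circle x"
      by (metis Quotient3_abs_rep Quotient3_circle)
    then obtain k :: int where "rep_circle (to_circle x) - x = of_int k"
      unfolding to_circle_eq_iff by (auto elim: Ints_cases)
    then have "rep_circle (to_circle x) = x + of_int k" by simp
    then show ?thesis using infdist_add_of_int[OF C ne per] by (simp add: g_def)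
  qed
  have gcont: "continuous_on UNIV g"
    by (subst continuous_on_circle_iff) (simp add: g continuous_on_infdist)
  have g0: "g c \<ge> 0" for c by (simp add: g_def infdist_nonneg)
  define f where "f n c = min 1 (real n * g c)" for n c
  show ?thesis
  proof (intro exI[of _ f] conjI allI)
    fix n c
    show f1: "\<bar>f n c\<bar> \<le> 1" for n c using g0[of c] by (simp add: f_def)
    show "f n \<in> bcontfun"
      unfolding bcontfun_def using f1 gcont
      by (auto simp: f_def[abs_def] bounded_iff intro!: continuous_intros)
    obtain x where x: "c = to_circle x" using to_circle_surj by blast
    show "(\<lambda>n. f n c) \<longlonglongrightarrow> indicator U c"
    proof (cases "c \<in> U")
      case True
      then have "x \<notin> C" by (simp add: C_def x)
      then have pos: "g c > 0"
        unfolding x g using C ne infdist_nonneg[of x C] in_closed_iff_infdist_zero by (metis less_le)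
      obtain n0 where n0: "real n0 * g c > 1" using ex_less_of_nat_mult[OF pos] by blast
      have "f n c = 1" if "n \<ge> n0" for n
      proof -
        have "real n0 * g c \<le> real n * g c" using that pos by (intro mult_right_mono) auto
        then show ?thesis using n0 by (simp add: f_def)
      qed
      then have "eventually (\<lambda>n. f n c = 1) sequentially"
        by (auto simp: eventually_sequentially)
      then show ?thesis using True by (simp add: tendsto_eventually)
    next
      case False
      then have "x \<in> C" by (simp add: C_def x)
      then have "f n c = 0" for n by (simp add: f_def x g)
      then show ?thesis using False by simp
    qed
  qed
qed

text \<open>Open sets are an intersection-stable generator of the Borel sets, and by dominated
  convergence the measure of an open set is a limit of integrals of the functions from
  \<open>open_circle_approx\<close>.\<close>

lemma borel_prob_measures_circle_eqI:
  fixes \<mu> \<nu> :: "circle measure"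
  assumes "\<mu> \<in> borel_prob_measures" "\<nu> \<in> borel_prob_measures"
    and eq: "\<And>f :: circle \<Rightarrow> real. f \<in> bcontfun \<Longrightarrow> (\<integral>x. f x \<partial>\<mu>) = (\<integral>x. f x \<partial>\<nu>)"
  shows "\<mu> = \<nu>"
proof (rule measure_eqI_generator_eq[where E = "{S. open S}" and \<Omega> = UNIV and A = "\<lambda>_. UNIV"])
  interpret m: prob_space \<mu> using assms(1) by (simp add: borel_prob_measures_def)
  interpret n: prob_space \<nu> using assms(2) by (simp add: borel_prob_measures_def)
  have sets: "sets \<mu> = sets borel" "sets \<nu> = sets borel"
    using assms by (auto simp: borel_prob_measures_def)
  then show "sets \<mu> = sigma_sets UNIV {S. open S}" "sets \<nu> = sigma_sets UNIV {S. open S}"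
    by (auto simp: sets_borel)
  show "Int_stable {S :: circle set. open S}" by (auto simp: Int_stable_def)
  show "emeasure \<mu> UNIV \<noteq> \<infinity>" for i :: nat by simp
  fix U :: "circle set" assume "U \<in> {S. open S}"
  then have U: "open U" by simp
  obtain f :: "nat \<Rightarrow> circle \<Rightarrow> real" where f: "\<And>n. f n \<in> bcontfun" "\<And>n c. \<bar>f n c\<bar> \<le> 1"
    "\<And>c. (\<lambda>n. f n c) \<longlonglongrightarrow> indicator U c"
    using open_circle_approx[OF U] by blast
  have *: "(\<lambda>n. \<integral>c. f n c \<partial>\<rho>) \<longlonglongrightarrow> measure \<rho> U"
    if \<rho>: "prob_space \<rho>" "sets \<rho> = sets borel" for \<rho> :: "circle measure"
  proof -
    interpret prob_space \<rho> by fact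
    have "U \<in> sets \<rho>" using U \<rho>(2) by simp
    moreover have "f n \<in> borel_measurable \<rho>" for n
      using bcontfun_measurable[OF f(1)] \<rho>(2) by (simp cong: measurable_cong_sets)
    ultimately have "(\<lambda>n. \<integral>c. f n c \<partial>\<rho>) \<longlonglongrightarrow> (\<integral>c. indicator U c \<partial>\<rho>)"
      using f(2,3) by (intro integral_dominated_convergence[where w = "\<lambda>_. 1"]) auto
    then show ?thesis using \<open>U \<in> sets \<rho>\<close> by simp
  qed
  have "measure \<mu> U = measure \<nu> U"
    using LIMSEQ_unique[OF *[of \<mu>] *[of \<nu>, unfolded eq[OF f(1), symmetric]]]
      m.prob_space_axioms n.prob_space_axioms sets by simp
  then show "emeasure \<mu> U = emeasure \<nu> U"
    by (simp add: m.emeasure_eq_measure n.emeasure_eq_measure)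
qed auto

section \<open>Push-forwards and invariance\<close>

lemma invariant_under_iff_distr:
  assumes "\<mu> \<in> borel_prob_measures" "continuous_on UNIV T"
  shows "invariant_under T \<mu> \<longleftrightarrow> distr \<mu> borel T = \<mu>"
proof -
  have s: "sets \<mu> = sets borel" "space \<mu> = UNIV"
    using assms(1) sets_eq_imp_space_eq[of \<mu> borel] by (auto simp: borel_prob_measures_def)
  have T: "T \<in> measurable \<mu> borel"
    using borel_measurable_continuous_onI[OF assms(2)] s(1) by (simp cong: measurable_cong_sets)
  show ?thesis
  proof
    assume "invariant_under T \<mu>"
    then show "distr \<mu> borel T = \<mu>"
      using T s by (intro measure_eqI) (auto simp: emeasure_distr invariant_under_def)
  next
    assume "distr \<mu> borel T = \<mu>"
    then have "emeasure \<mu> (T -` A) = emeasure \<mu> A" if "A \<in> sets borel" for A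
      using emeasure_distr[OF T that] s by simp
    then show "invariant_under T \<mu>" by (simp add: invariant_under_def)
  qed
qed

lemma
  assumes "\<mu> \<in> borel_prob_measures" "continuous_on UNIV T"
  shows distr_in_borel_prob_measures: "distr \<mu> borel T \<in> borel_prob_measures"
    and integral_distr_bcontfun: "f \<in> bcontfun \<Longrightarrow> (\<integral>x. f x \<partial>distr \<mu> borel T) = (\<integral>x. f (T x) \<partial>\<mu> :: real)"
proof -
  interpret prob_space \<mu> using assms(1) by (simp add: borel_prob_measures_def)
  have T: "T \<in> measurable \<mu> borel"
    using borel_measurable_continuous_onI[OF assms(2)] assms(1)
    by (simp add: borel_prob_measures_def cong: measurable_cong_sets)
  show "distr \<mu> borel T \<in> borel_prob_measures"
    using prob_space_distr[OF T] by (simp add: borel_prob_measures_def)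
  show "(\<integral>x. f x \<partial>distr \<mu> borel T) = (\<integral>x. f (T x) \<partial>\<mu>)" if "f \<in> bcontfun"
    using T bcontfun_measurable[OF that] by (rule integral_distr)
qed

lemma integral_invariant_under:
  fixes f :: "'a::topological_space \<Rightarrow> real"
  assumes "\<mu> \<in> borel_prob_measures" "continuous_on UNIV T" "invariant_under T \<mu>" "f \<in> bcontfun"
  shows "(\<integral>x. f (T x) \<partial>\<mu>) = (\<integral>x. f x \<partial>\<mu>)"
  using integral_distr_bcontfun[OF assms(1,2,4)] assms invariant_under_iff_distr by metis

lemma limit_measures_invariant:
  assumes "\<mu> \<in> limit_measures (mult_seq (\<lambda>k. 2 ^ k) \<alpha>)"
  shows "invariant_under (mult_circle 2) \<mu>"
proof -
  let ?T = "mult_circle 2" and ?x = "mult_seq (\<lambda>k. 2 ^ k) \<alpha>"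
  have pm: "\<mu> \<in> borel_prob_measures" using assms by (simp add: limit_measures_iff)
  have T: "continuous_on UNIV ?T" by (rule continuous_mult_circle)
  have "distr \<mu> borel ?T = \<mu>"
  proof (rule borel_prob_measures_circle_eqI)
    fix f :: "circle \<Rightarrow> real" assume f: "f \<in> bcontfun"
    have fT: "(\<lambda>x. f (?T x)) \<in> bcontfun" by (rule bcontfun_compose[OF f T])
    obtain B where B: "\<And>x. \<bar>f x\<bar> \<le> B" using bcontfun_finite_bound[of "{f}"] f by auto
    have "\<bar>(\<integral>x. f (?T x) \<partial>\<mu>) - (\<integral>x. f x \<partial>\<mu>)\<bar> \<le> e" if e: "e > 0" for e
    proof -
      \<comment> \<open>From this \<open>N0\<close> on, the boundary term \<open>2 * B / N\<close>
        is at most \<open>e / 3\<close>.\<close>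
      obtain N0 :: nat where N0: "real N0 > 6 * B / e" using reals_Archimedean2 by blast
      \<comment> \<open>Testing \<open>f\<close> and its composite with \<open>?T\<close> together
        yields one \<open>N\<close> that serves both averages.\<close>
      obtain N where N: "N \<ge> N0" "N \<ge> 1" and
        avg: "\<forall>h\<in>{f, \<lambda>x. f (?T x)}. \<bar>(\<Sum>n=1..N. h (?x n)) / real N - (\<integral>y. h y \<partial>\<mu>)\<bar> < e / 3"
        using assms e f fT unfolding limit_measures_iff
        by (elim conjE allE[of _ "{f, \<lambda>x. f (?T x)}"] allE[of _ "e / 3"] allE[of _ N0]) auto
      have step: "?T (?x n) = ?x (Suc n)" for n by (simp add: mult_seq_def mult_circle_mult)
      \<comment> \<open>Since \<open>?T\<close> shifts the index by one along the orbit, the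
        difference telescopes.\<close>
      have "(\<Sum>n=1..N. f (?T (?x n))) - (\<Sum>n=1..N. f (?x n)) = f (?x (Suc N)) - f (?x 1)"
        unfolding step sum_subtractf[symmetric] using N(2)
        by (intro sum_Suc_diff) auto
      then have "\<bar>(\<Sum>n=1..N. f (?T (?x n))) - (\<Sum>n=1..N. f (?x n))\<bar> \<le> 2 * B"
        using B[of "?x (Suc N)"] B[of "?x 1"] by linarith
      then have "\<bar>(\<Sum>n=1..N. f (?T (?x n))) / N - (\<Sum>n=1..N. f (?x n)) / N\<bar> \<le> 2 * B / N"
        using N(2) by (simp add: diff_divide_distrib[symmetric] divide_right_mono)
      also have "2 * B / N \<le> e / 3"
      proof -
        have "6 * B / e < real N" using N0 N(1) by linarith
        then have "6 * B < e * real N" using e by (simp add: pos_divide_less_eq mult.commute)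
        then show ?thesis using N(2) by (simp add: pos_divide_le_eq)
      qed
      finally have "\<bar>(\<Sum>n=1..N. f (?T (?x n))) / N - (\<Sum>n=1..N. f (?x n)) / N\<bar> \<le> e / 3" .
      moreover have "\<bar>(\<Sum>n=1..N. f (?x n)) / real N - (\<integral>y. f y \<partial>\<mu>)\<bar> < e / 3"
        "\<bar>(\<Sum>n=1..N. f (?T (?x n))) / real N - (\<integral>y. f (?T y) \<partial>\<mu>)\<bar> < e / 3"
        using avg[rule_format, of f] avg[rule_format, of "\<lambda>x. f (?T x)"] by simp_all
      ultimately show ?thesis by linarith
    qed
    then have "(\<integral>x. f (?T x) \<partial>\<mu>) = (\<integral>x. f x \<partial>\<mu>)"
      using field_le_epsilon[of "\<bar>(\<integral>x. f (?T x) \<partial>\<mu>) - (\<integral>x. f x \<partial>\<mu>)\<bar>" 0] by simp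
    then show "(\<integral>x. f x \<partial>distr \<mu> borel ?T) = (\<integral>x. f x \<partial>\<mu>)"
      using integral_distr_bcontfun[OF pm T f] by simp
  qed (use distr_in_borel_prob_measures[OF pm T] pm in auto)
  then show ?thesis using invariant_under_iff_distr[OF pm T] by simp
qed

section \<open>Periodic orbits approximating an invariant measure\<close>

text \<open>A derandomized law of large numbers: averaging over the next sample point shows that it can be
  chosen so that the sum of the squared deviations grows by at most a constant.\<close>

lemma (in prob_space) greedy_sample:
  fixes g :: "'i \<Rightarrow> 'a \<Rightarrow> real"
  assumes "finite I" "\<And>i. i \<in> I \<Longrightarrow> g i \<in> borel_measurable M"
    and B: "\<And>i x. i \<in> I \<Longrightarrow> \<bar>g i x\<bar> \<le> B"
  shows "\<exists>x :: nat \<Rightarrow> 'a.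
    (\<Sum>i\<in>I. (\<Sum>j<A. g i (x j) - expectation (g i))\<^sup>2) \<le> real A * (\<Sum>i\<in>I. (2 * B)\<^sup>2)"
proof (induction A)
  case (Suc A)
  then obtain x where
    x: "(\<Sum>i\<in>I. (\<Sum>j<A. g i (x j) - expectation (g i))\<^sup>2) \<le> real A * (\<Sum>i\<in>I. (2 * B)\<^sup>2)" by blast
  define S where "S i = (\<Sum>j<A. g i (x j) - expectation (g i))" for i
  define Z where "Z i y = g i y - expectation (g i)" for i y
  have int: "integrable M (g i)" if "i \<in> I" for i
    using assms that by (intro integrable_const_bound[of _ B]) auto
  have Zm: "Z i \<in> borel_measurable M" if "i \<in> I" for i
    using assms(2)[OF that] by (simp add: Z_def[abs_def])
  have ZB: "\<bar>Z i y\<bar> \<le> 2 * B" if "i \<in> I" for i y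
  proof -
    have "\<bar>expectation (g i)\<bar> \<le> expectation (\<lambda>x. \<bar>g i x\<bar>)" by (rule integral_abs_bound)
    also have "\<dots> \<le> B" using B int that by (intro integral_le_const) auto
    finally show ?thesis using B[OF that, of y] by (simp add: Z_def)
  qed
  have Zint: "integrable M (Z i)" and Z0: "expectation (Z i) = 0" if "i \<in> I" for i
    using int[OF that] by (simp_all add: Z_def[abs_def] prob_space)
  have Z2: "(Z i y)\<^sup>2 \<le> (2 * B)\<^sup>2" if "i \<in> I" for i y
    using ZB[OF that, of y] abs_le_square_iff abs_ge_self order_trans by metis
  have Z2int: "integrable M (\<lambda>y. (Z i y)\<^sup>2)" if "i \<in> I" for i
    using Z2[OF that] Zm[OF that] by (intro integrable_const_bound[of _ "(2 * B)\<^sup>2"]) auto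
  have square_bound: "integrable M (\<lambda>y. (S i + Z i y)\<^sup>2)"
    "expectation (\<lambda>y. (S i + Z i y)\<^sup>2) \<le> (S i)\<^sup>2 + (2 * B)\<^sup>2" if "i \<in> I" for i
  proof -
    \<comment> \<open>The cross term has mean zero, so the expected growth of the square is the
      second moment of \<open>Z i\<close>.\<close>
    have eq: "(\<lambda>y. (S i + Z i y)\<^sup>2) = (\<lambda>y. (S i)\<^sup>2 + (2 * S i) * Z i y + (Z i y)\<^sup>2)"
      by (simp add: power2_eq_square algebra_simps)
    show "integrable M (\<lambda>y. (S i + Z i y)\<^sup>2)"
      unfolding eq using Zint[OF that] Z2int[OF that] by simp
    have "expectation (\<lambda>y. (S i + Z i y)\<^sup>2) = (S i)\<^sup>2 + expectation (\<lambda>y. (Z i y)\<^sup>2)"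
      unfolding eq using Zint[OF that] Z2int[OF that] Z0[OF that] by (simp add: prob_space)
    also have "expectation (\<lambda>y. (Z i y)\<^sup>2) \<le> (2 * B)\<^sup>2"
      using Z2[OF that] Z2int[OF that] by (intro integral_le_const) auto
    finally show "expectation (\<lambda>y. (S i + Z i y)\<^sup>2) \<le> (S i)\<^sup>2 + (2 * B)\<^sup>2" by simp
  qed
  have "\<exists>y. (\<Sum>i\<in>I. (S i + Z i y)\<^sup>2) \<le> (\<Sum>i\<in>I. (S i)\<^sup>2 + (2 * B)\<^sup>2)"
  \<comment> \<open>If every \<open>y\<close> exceeded the bound, so would the mean over
    \<open>y\<close>.\<close>
  proof (rule ccontr)
    assume "\<not> ?thesis"
    then have "(\<Sum>i\<in>I. (S i)\<^sup>2 + (2 * B)\<^sup>2) < expectation (\<lambda>y. \<Sum>i\<in>I. (S i + Z i y)\<^sup>2)"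
      using square_bound by (intro expectation_greater) (auto simp: not_le)
    also have "\<dots> = (\<Sum>i\<in>I. expectation (\<lambda>y. (S i + Z i y)\<^sup>2))"
      using square_bound by (intro Bochner_Integration.integral_sum) auto
    also have "\<dots> \<le> (\<Sum>i\<in>I. (S i)\<^sup>2 + (2 * B)\<^sup>2)" using square_bound by (intro sum_mono)
    finally show False by simp
  qed
  then obtain y where y: "(\<Sum>i\<in>I. (S i + Z i y)\<^sup>2) \<le> (\<Sum>i\<in>I. (S i)\<^sup>2 + (2 * B)\<^sup>2)" by blast
  \<comment> \<open>The new point goes to index \<open>A\<close>, which the sums over
    \<open>j < A\<close> do not read.\<close>
  have "(\<Sum>j<Suc A. g i ((x(A := y)) j) - expectation (g i)) = S i + Z i y" for i
    by (simp add: S_def Z_def)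
  then have "(\<Sum>i\<in>I. (\<Sum>j<Suc A. g i ((x(A := y)) j) - expectation (g i))\<^sup>2) =
      (\<Sum>i\<in>I. (S i + Z i y)\<^sup>2)" by presburger
  also have "\<dots> \<le> (\<Sum>i\<in>I. (S i)\<^sup>2) + (\<Sum>i\<in>I. (2 * B)\<^sup>2)" using y by (simp add: sum.distrib)
  also have "\<dots> \<le> real (Suc A) * (\<Sum>i\<in>I. (2 * B)\<^sup>2)"
    using x by (simp add: S_def algebra_simps)
  finally show ?case by blast
qed simp

text \<open>By \<open>greedy_sample\<close> each squared deviation is at most A K, hence below the
  square of A \<epsilon> as soon as A exceeds \<open>K / \<epsilon>\<^sup>2\<close>.\<close>

lemma (in prob_space) sample_means_approx:
  fixes g :: "'i \<Rightarrow> 'a \<Rightarrow> real"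
  assumes "finite I" "\<And>i. i \<in> I \<Longrightarrow> g i \<in> borel_measurable M"
    and "\<And>i x. i \<in> I \<Longrightarrow> \<bar>g i x\<bar> \<le> B" and "\<epsilon> > 0"
  shows "\<exists>A\<ge>1. \<exists>x :: nat \<Rightarrow> 'a. \<forall>i\<in>I. \<bar>(\<Sum>j<A. g i (x j)) - real A * expectation (g i)\<bar> < real A * \<epsilon>"
proof -
  define K where "K = (\<Sum>i\<in>I. (2 * B)\<^sup>2)"
  obtain A0 :: nat where A0: "real A0 > K / \<epsilon>\<^sup>2" using reals_Archimedean2 by blast
  define A where "A = max A0 1"
  have A: "A \<ge> 1" "real A > K / \<epsilon>\<^sup>2" using A0 by (auto simp: A_def)
  obtain x where x: "(\<Sum>i\<in>I. (\<Sum>j<A. g i (x j) - expectation (g i))\<^sup>2) \<le> real A * K"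
    using greedy_sample[where I = I and g = g and B = B and A = A] assms(1-3) unfolding K_def by blast
  have "\<bar>(\<Sum>j<A. g i (x j)) - real A * expectation (g i)\<bar> < real A * \<epsilon>" if "i \<in> I" for i
  proof -
    have "(\<Sum>j<A. g i (x j) - expectation (g i))\<^sup>2 \<le> real A * K"
      using x member_le_sum[of i I "\<lambda>i. (\<Sum>j<A. g i (x j) - expectation (g i))\<^sup>2"] that assms(1)
      by simp
    also have "\<dots> < real A * (real A * \<epsilon>\<^sup>2)"
      using A assms(4) by (intro mult_strict_left_mono) (auto simp: pos_divide_less_eq)
    also have "\<dots> = (real A * \<epsilon>)\<^sup>2" by (simp add: power2_eq_square)
    finally have "\<bar>\<Sum>j<A. g i (x j) - expectation (g i)\<bar> < \<bar>real A * \<epsilon>\<bar>"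
      using abs_le_square_iff not_le by metis
    then show ?thesis using assms(4) by (simp add: sum_subtractf)
  qed
  with A(1) show ?thesis by blast
qed

text \<open>Concatenates the first \<open>L\<close> binary digits of \<open>x 0\<close>,
  \<open>x 1\<close>, and so on; multiplication by \<open>2 ^ (i * L)\<close> brings the block of
  \<open>x i\<close> to the front. The induction prepends one block, so it is applied to the shifted
  sequence; \<open>0 \<le> y\<close> and \<open>y < 1\<close> keep the tail from carrying into the
  new block.\<close>

lemma doubling_shadow:
  fixes x :: "nat \<Rightarrow> real"
  shows "\<exists>y. 0 \<le> y \<and> y < 1 \<and> (\<forall>i<A. \<exists>k::int. \<bar>2 ^ (i * L) * y - x i - of_int k\<bar> \<le> (1/2) ^ L)"
proof (induction A arbitrary: x)
  case 0
  show ?case by (rule exI[of _ 0]) simp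
next
  case (Suc A)
  from Suc[of "\<lambda>i. x (Suc i)"] obtain y' where y': "0 \<le> y'" "y' < 1"
    "\<And>i. i < A \<Longrightarrow> \<exists>k::int. \<bar>2 ^ (i * L) * y' - x (Suc i) - of_int k\<bar> \<le> (1/2) ^ L" by blast
  \<comment> \<open>The integer whose binary digits are the first \<open>L\<close> digits of
    \<open>x 0\<close>.\<close>
  define q where "q = \<lfloor>2 ^ L * frac (x 0)\<rfloor>"
  define y where "y = (of_int q + y') / 2 ^ L"
  have q0: "q \<ge> 0" by (simp add: q_def)
  have "2 ^ L * frac (x 0) < (2::real) ^ L" using frac_lt_1[of "x 0"] by simp
  then have "q + 1 \<le> 2 ^ L" by (simp add: q_def floor_less_iff add1_zle_eq)
  then have q1: "real_of_int q + 1 \<le> 2 ^ L"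
    by (simp flip: of_int_le_iff[where 'a = real])
  have "2 ^ L * y = of_int q + y'" by (simp add: y_def)
  show ?case
  proof (intro exI[of _ y] conjI allI impI)
    show "0 \<le> y" using q0 y' by (simp add: y_def)
    show "y < 1" using q1 y' by (simp add: y_def)
    fix i assume i: "i < Suc A"
    show "\<exists>k::int. \<bar>2 ^ (i * L) * y - x i - of_int k\<bar> \<le> (1/2) ^ L"
    proof (cases i)
      case 0
      have "\<bar>(of_int q + y') - 2 ^ L * frac (x 0)\<bar> \<le> 1"
        unfolding q_def using y' by linarith
      then have "\<bar>2 ^ L * (y - frac (x 0))\<bar> \<le> 1"
        using \<open>2 ^ L * y = of_int q + y'\<close> by (simp add: right_diff_distrib)
      then have "2 ^ L * \<bar>y - frac (x 0)\<bar> \<le> 1" by (simp add: abs_mult)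
      then have "\<bar>y - frac (x 0)\<bar> \<le> (1/2) ^ L"
        by (simp add: power_divide pos_le_divide_eq mult.commute)
      then show ?thesis using 0 by (intro exI[of _ "- \<lfloor>x 0\<rfloor>"]) (simp add: frac_def algebra_simps)
    next
      case (Suc j)
      with i y'(3)[of j] obtain k :: int where
        k: "\<bar>2 ^ (j * L) * y' - x (Suc j) - of_int k\<bar> \<le> (1/2) ^ L" by auto
      have "2 ^ (i * L) * y = 2 ^ (j * L) * (2 ^ L * y)" by (simp add: Suc power_add)
      also have "\<dots> = 2 ^ (j * L) * of_int q + 2 ^ (j * L) * y'"
        by (simp add: \<open>2 ^ L * y = of_int q + y'\<close> distrib_left)
      \<comment> \<open>Modulo integers, multiplying by \<open>2 ^ L\<close> removes the prepended
        block and leaves \<open>y'\<close>.\<close>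
      finally have "2 ^ (i * L) * y - x i - of_int (k + 2 ^ (j * L) * q) =
          2 ^ (j * L) * y' - x (Suc j) - of_int k" by (simp add: Suc)
      with k show ?thesis by metis
    qed
  qed
qed

text \<open>Repeating the first \<open>A * L\<close> digits of the point from
  \<open>doubling_shadow\<close> forever makes it rational and periodic, at the price of a second
  error \<open>(1/2) ^ L\<close>.\<close>

lemma doubling_shadow_periodic:
  fixes x :: "nat \<Rightarrow> real"
  assumes "A \<ge> 1" "L \<ge> 1"
  shows "\<exists>z\<in>\<rat>. (\<exists>k::int. 2 ^ (A * L) * z = z + of_int k) \<and>
    (\<forall>i<A. \<exists>k::int. \<bar>2 ^ (i * L) * z - x i - of_int k\<bar> \<le> 2 * (1/2) ^ L)"
proof -
  obtain y where y: "0 \<le> y" "y < 1"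
    "\<And>i. i < A \<Longrightarrow> \<exists>k::int. \<bar>2 ^ (i * L) * y - x i - of_int k\<bar> \<le> (1/2) ^ L"
    using doubling_shadow[of A L x] by blast
  define P :: real where "P = 2 ^ (A * L)"
  have P: "P \<ge> 2" unfolding P_def using assms power_increasing[of 1 "A * L" "2::real"] by simp
  define c where "c = \<lfloor>P * y\<rfloor>"
  \<comment> \<open>The value of the purely periodic expansion c/P + c/P^2 + ..., with period block
    \<open>c\<close>.\<close>
  define z where "z = of_int c / (P - 1)"
  have c: "of_int c \<le> P * y" "P * y < of_int c + 1" "c \<ge> 0"
    using y P by (auto simp: c_def)
  have Py: "P * y < P" using y P by simp
  have Pint: "P = of_int (2 ^ (A * L))" by (simp add: P_def)
  have "of_int c < real_of_int (2 ^ (A * L))" using c(1) Py Pint by linarith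
  then have "c + 1 \<le> 2 ^ (A * L)" by linarith
  \<comment> \<open>This is what \<open>z \<le> (c + 1) / P\<close> amounts to; then
    \<open>z\<close> and \<open>y\<close> lie in the same interval of length
    \<open>1 / P\<close>.\<close>
  then have c1: "of_int c + 1 \<le> P" unfolding Pint by (metis of_int_1 of_int_add of_int_le_iff)
  have "of_int c / P \<le> z" unfolding z_def using P c by (intro divide_left_mono) auto
  moreover have "z \<le> (of_int c + 1) / P"
    unfolding z_def using P c1 by (simp add: divide_simps) (simp add: algebra_simps)
  moreover have "of_int c / P \<le> y" "y \<le> (of_int c + 1) / P"
    using c P by (auto simp: field_simps)
  ultimately have zy: "\<bar>z - y\<bar> \<le> 1 / P" by (auto simp: add_divide_distrib)
  have "z \<in> \<rat>" unfolding z_def Pint by (intro Rats_divide Rats_diff) auto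
  moreover have "P * z = z + of_int c" unfolding z_def using P by (simp add: field_simps)
  moreover have "\<exists>k::int. \<bar>2 ^ (i * L) * z - x i - of_int k\<bar> \<le> 2 * (1/2) ^ L" if i: "i < A" for i
  proof -
    obtain k :: int where k: "\<bar>2 ^ (i * L) * y - x i - of_int k\<bar> \<le> (1/2) ^ L" using y(3) i by blast
    have "\<bar>2 ^ (i * L) * z - 2 ^ (i * L) * y\<bar> = 2 ^ (i * L) * \<bar>z - y\<bar>"
      by (simp add: right_diff_distrib[symmetric] abs_mult)
    also have "\<dots> \<le> 2 ^ (i * L) * (1 / P)" using zy by (intro mult_left_mono) auto
    also have "\<dots> \<le> (1/2) ^ L"
    proof -
      \<comment> \<open>At least one whole block remains after time \<open>i * L\<close>, so the
        expanded error is still at most \<open>(1/2) ^ L\<close>.\<close>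
      have "i * L + L \<le> A * L" using i by (metis Suc_leI add.commute mult_Suc mult_le_mono1)
      then have "(2::real) ^ (i * L + L) \<le> P" unfolding P_def by (intro power_increasing) auto
      then show ?thesis using P by (simp add: power_add power_divide field_simps)
    qed
    finally have "\<bar>2 ^ (i * L) * z - 2 ^ (i * L) * y\<bar> \<le> (1/2) ^ L" .
    with k have "\<bar>2 ^ (i * L) * z - x i - of_int k\<bar> \<le> 2 * (1/2) ^ L" by linarith
    then show ?thesis by blast
  qed
  ultimately show ?thesis unfolding P_def by blast
qed

lemma integral_mult_circle_power:
  fixes f :: "circle \<Rightarrow> real"
  assumes "\<mu> \<in> borel_prob_measures" "invariant_under (mult_circle 2) \<mu>" "f \<in> bcontfun"
  shows "(\<integral>x. f (mult_circle (2 ^ j) x) \<partial>\<mu>) = (\<integral>x. f x \<partial>\<mu>)"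
proof (induction j)
  case 0
  have "mult_circle 1 x = x" for x using to_circle_surj[of x] by auto
  then show ?case by simp
next
  case (Suc j)
  have "(\<lambda>x. f (mult_circle (2 ^ j) x)) \<in> bcontfun"
    by (rule bcontfun_compose[OF assms(3) continuous_mult_circle])
  from integral_invariant_under[OF assms(1) continuous_mult_circle assms(2) this] Suc
  show ?case by (simp add: mult_circle_mult mult.commute)
qed

lemma sum_lessThan_mult:
  fixes h :: "nat \<Rightarrow> 'a::comm_monoid_add"
  shows "(\<Sum>n<q * K. h n) = (\<Sum>m<q. \<Sum>j<K. h (m * K + j))"
proof -
  have "sum h {m * K..<m * K + K} = (\<Sum>j<K. h (m * K + j))" for m
    using sum.shift_bounds_nat_ivl[of h 0 "m * K" K] by (simp add: lessThan_atLeast0 add.commute)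
  then show ?thesis by (simp flip: sum.nat_group)
qed

lemma sum_two_power_le: "(\<Sum>n<N. 2 ^ n :: real) \<le> 2 ^ N"
  by (induction N) auto

text \<open>Sample starting points whose block sums \<open>g f\<close> have nearly the right mean,
  then join the blocks into one periodic orbit. Within a block the distances grow geometrically, so
  they cost only \<open>2 * C\<close> in total, whatever \<open>L\<close> is; a long block makes
  this negligible.\<close>

lemma periodic_orbit_approx:
  fixes F :: "(circle \<Rightarrow> real) set"
  assumes \<mu>: "\<mu> \<in> borel_prob_measures" "invariant_under (mult_circle 2) \<mu>"
    and F: "finite F" "F \<subseteq> bcontfun" and \<epsilon>: "\<epsilon> > 0"
  shows "\<exists>z\<in>\<rat>. \<exists>K\<ge>1. mult_circle (2 ^ K) (to_circle z) = to_circle z \<and>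
    (\<forall>f\<in>F. \<bar>(\<Sum>n<K. f (mult_circle (2 ^ n) (to_circle z))) - real K * (\<integral>x. f x \<partial>\<mu>)\<bar> < real K * \<epsilon>)"
proof -
  interpret prob_space \<mu> using \<mu>(1) by (simp add: borel_prob_measures_def)
  obtain C where C: "C \<ge> 0" and mod: "\<And>f x y. f \<in> F \<Longrightarrow>
      \<bar>f (to_circle x) - f (to_circle y)\<bar> \<le> \<epsilon> / 4 + C * \<bar>x - y\<bar>"
    using continuous_modulus_circle_finite[OF F, of "\<epsilon> / 4"] \<epsilon> by auto
  obtain B where B: "B \<ge> 0" "\<And>f x. f \<in> F \<Longrightarrow> \<bar>f x\<bar> \<le> B"
    using bcontfun_finite_bound[OF F] by blast
  \<comment> \<open>Chosen to make the cost \<open>2 * C\<close> of a block at most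
    \<open>real L * (\<epsilon> / 4)\<close>.\<close>
  obtain L0 :: nat where L0: "real L0 > 8 * C / \<epsilon>" using reals_Archimedean2 by blast
  define L where "L = max L0 1"
  have "8 * C / \<epsilon> < real L" using L0 by (simp add: L_def)
  then have "8 * C < real L * \<epsilon>" using \<epsilon> by (simp only: pos_divide_less_eq)
  then have L: "L \<ge> 1" "2 * C \<le> real L * (\<epsilon> / 4)" by (simp_all add: L_def)
  define g where "g f c = (\<Sum>j<L. f (mult_circle (2 ^ j) c))" for f :: "circle \<Rightarrow> real" and c
  have fj: "(\<lambda>x. f (mult_circle (2 ^ j) x)) \<in> bcontfun" if "f \<in> F" for f j
    using F that bcontfun_compose[OF _ continuous_mult_circle] by blast
  have "sets \<mu> = sets borel" using \<mu>(1) by (simp add: borel_prob_measures_def)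
  then have gm: "g f \<in> borel_measurable \<mu>" if "f \<in> F" for f
    unfolding g_def using bcontfun_measurable[OF fj[OF that]]
    by (intro borel_measurable_sum) (simp cong: measurable_cong_sets)
  have gB: "\<bar>g f c\<bar> \<le> real L * B" if "f \<in> F" for f c
  proof -
    have "\<bar>g f c\<bar> \<le> (\<Sum>j<L. \<bar>f (mult_circle (2 ^ j) c)\<bar>)" unfolding g_def by (rule sum_abs)
    also have "\<dots> \<le> (\<Sum>j<L. B)" using B(2) that by (intro sum_mono)
    finally show ?thesis by simp
  qed
  \<comment> \<open>By invariance all \<open>L\<close> terms of the block have the same
    integral.\<close>
  have gint: "expectation (g f) = real L * (\<integral>x. f x \<partial>\<mu>)" if "f \<in> F" for f
  proof -
    have "f \<in> bcontfun" using F that by auto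
    then show ?thesis
      unfolding g_def using bcontfun_integrable[OF \<mu>(1) fj[OF that]]
      by (simp add: integral_mult_circle_power[OF \<mu>])
  qed
  have Le: "real L * (\<epsilon> / 4) > 0" using L \<epsilon> by simp
  obtain A and c :: "nat \<Rightarrow> circle" where A: "A \<ge> 1" and
    c: "\<And>f. f \<in> F \<Longrightarrow> \<bar>(\<Sum>i<A. g f (c i)) - real A * expectation (g f)\<bar> < real A * (real L * (\<epsilon> / 4))"
    using sample_means_approx[where I = F and g = g and B = "real L * B", OF F(1) gm gB Le] by blast
  have "\<exists>r. \<forall>i. c i = to_circle (r i)"
    by (intro choice allI to_circle_surj)
  then obtain r where r: "\<And>i. c i = to_circle (r i)" by blast
  obtain z where z: "z \<in> \<rat>" "\<exists>k::int. 2 ^ (A * L) * z = z + of_int k"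
    "\<And>i. i < A \<Longrightarrow> \<exists>k::int. \<bar>2 ^ (i * L) * z - r i - of_int k\<bar> \<le> 2 * (1/2) ^ L"
    using doubling_shadow_periodic[OF A L(1), of r] by blast
  have per: "mult_circle (2 ^ (A * L)) (to_circle z) = to_circle z"
    using z(2) by (auto simp: to_circle_eq_iff)
  have close: "\<bar>(\<Sum>n<A * L. f (mult_circle (2 ^ n) (to_circle z))) - (\<Sum>i<A. g f (c i))\<bar>
      \<le> real A * (real L * (\<epsilon> / 4) + 2 * C)" if f: "f \<in> F" for f
  proof -
    let ?h = "\<lambda>n. f (mult_circle (2 ^ n) (to_circle z))"
    have block: "\<bar>(\<Sum>j<L. ?h (i * L + j)) - g f (c i)\<bar> \<le> real L * (\<epsilon> / 4) + 2 * C" if i: "i < A" for i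
    proof -
      obtain k :: int where k: "\<bar>2 ^ (i * L) * z - r i - of_int k\<bar> \<le> 2 * (1/2) ^ L"
        using z(3)[OF i] by blast
      have one: "\<bar>?h (i * L + j) - f (mult_circle (2 ^ j) (c i))\<bar> \<le> \<epsilon> / 4 + C * (2 ^ j * (2 * (1/2) ^ L))" for j
      proof -
        define u where "u = 2 ^ j * (2 ^ (i * L) * z - of_int k)"
        have "2 ^ (i * L + j) * z = u + of_int (2 ^ j * k)"
          by (simp add: u_def power_add algebra_simps)
        then have "?h (i * L + j) = f (to_circle (u + of_int (2 ^ j * k)))" by simp
        also have "\<dots> = f (to_circle u)" by (simp only: to_circle_add_of_int)
        finally have h: "?h (i * L + j) = f (to_circle u)" .
        have "u - 2 ^ j * r i = 2 ^ j * (2 ^ (i * L) * z - r i - of_int k)"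
          by (simp add: u_def algebra_simps)
        then have "\<bar>u - 2 ^ j * r i\<bar> = 2 ^ j * \<bar>2 ^ (i * L) * z - r i - of_int k\<bar>"
          by (simp only: abs_mult) simp
        also have "\<dots> \<le> 2 ^ j * (2 * (1/2) ^ L)" using k by (intro mult_left_mono) auto
        finally have "C * \<bar>u - 2 ^ j * r i\<bar> \<le> C * (2 ^ j * (2 * (1/2) ^ L))"
          using C by (rule mult_left_mono)
        with mod[OF f, of u "2 ^ j * r i"] show ?thesis unfolding h r by simp
      qed
      have "\<bar>(\<Sum>j<L. ?h (i * L + j)) - g f (c i)\<bar>
          = \<bar>\<Sum>j<L. ?h (i * L + j) - f (mult_circle (2 ^ j) (c i))\<bar>"
        by (simp add: g_def sum_subtractf)
      also have "\<dots> \<le> (\<Sum>j<L. \<bar>?h (i * L + j) - f (mult_circle (2 ^ j) (c i))\<bar>)" by (rule sum_abs)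
      also have "\<dots> \<le> (\<Sum>j<L. \<epsilon> / 4 + C * (2 ^ j * (2 * (1/2) ^ L)))" using one by (intro sum_mono)
      also have "\<dots> = real L * (\<epsilon> / 4) + C * (2 * (1/2) ^ L) * (\<Sum>j<L. 2 ^ j)"
      proof -
        have "C * (2 ^ j * (2 * (1/2) ^ L)) = C * (2 * (1/2) ^ L) * 2 ^ j" for j by simp
        then show ?thesis by (simp only: sum.distrib sum_distrib_left) simp
      qed
      \<comment> \<open>The powers of 2 sum to at most \<open>2 ^ L\<close>, which cancels
        \<open>(1/2) ^ L\<close>.\<close>
      also have "\<dots> \<le> real L * (\<epsilon> / 4) + C * (2 * (1/2) ^ L) * 2 ^ L"
        using C sum_two_power_le[of L] by (intro add_left_mono mult_left_mono) auto
      also have "\<dots> = real L * (\<epsilon> / 4) + 2 * C" by (simp add: power_divide)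
      finally show ?thesis .
    qed
    have "\<bar>(\<Sum>n<A * L. ?h n) - (\<Sum>i<A. g f (c i))\<bar> = \<bar>\<Sum>i<A. (\<Sum>j<L. ?h (i * L + j)) - g f (c i)\<bar>"
      by (simp add: sum_lessThan_mult sum_subtractf)
    also have "\<dots> \<le> (\<Sum>i<A. \<bar>(\<Sum>j<L. ?h (i * L + j)) - g f (c i)\<bar>)" by (rule sum_abs)
    also have "\<dots> \<le> (\<Sum>i<A. real L * (\<epsilon> / 4) + 2 * C)" using block by (intro sum_mono) auto
    finally show ?thesis by simp
  qed
  have "\<bar>(\<Sum>n<A * L. f (mult_circle (2 ^ n) (to_circle z))) - real (A * L) * (\<integral>x. f x \<partial>\<mu>)\<bar>
      < real (A * L) * \<epsilon>" if f: "f \<in> F" for f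
  proof -
    have "\<bar>(\<Sum>n<A * L. f (mult_circle (2 ^ n) (to_circle z))) - real A * (real L * (\<integral>x. f x \<partial>\<mu>))\<bar>
      < real A * (real L * (\<epsilon> / 4)) + real A * (real L * (\<epsilon> / 4) + 2 * C)"
      using close[OF f] c[OF f] unfolding gint[OF f] by linarith
    \<comment> \<open>One quarter of \<epsilon> each for sampling, for the modulus of continuity and
      for the geometric sum.\<close>
    also have "\<dots> \<le> real A * (real L * (\<epsilon> / 4)) + real A * (real L * (\<epsilon> / 4) + real L * (\<epsilon> / 4))"
      using L(2) by (intro add_left_mono mult_left_mono) auto
    also have "\<dots> \<le> real A * (real L * \<epsilon>)"
      using \<epsilon> by (simp add: algebra_simps)
    finally show ?thesis by (simp add: mult.assoc)
  qed
  moreover have "A * L \<ge> 1" using A L by simp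
  ultimately show ?thesis using z(1) per by blast
qed

lemma periodic_orbit_sum:
  assumes "mult_circle (2 ^ K) c = c"
  shows "(\<Sum>n=1..q * K. f (mult_circle (2 ^ n) c)) = real q * (\<Sum>n<K. f (mult_circle (2 ^ n) c) :: real)"
proof -
  let ?h = "\<lambda>n. f (mult_circle (2 ^ n) c)"
  have per: "mult_circle (2 ^ (m * K)) c = c" for m
  proof (induction m)
    case 0
    show ?case using to_circle_surj[of c] by auto
  next
    case (Suc m)
    have "mult_circle (2 ^ (Suc m * K)) c = mult_circle (2 ^ (m * K)) (mult_circle (2 ^ K) c)"
      by (simp add: mult_circle_mult power_add mult.commute)
    then show ?case using assms Suc by simp
  qed
  have h: "?h (m * K + j) = ?h j" for m j
  proof -
    have "mult_circle (2 ^ (m * K + j)) c = mult_circle (2 ^ j) (mult_circle (2 ^ (m * K)) c)"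
      by (simp add: mult_circle_mult power_add mult.commute)
    then show ?thesis using per by simp
  qed
  \<comment> \<open>Moves the index range from \<open>1..q * K\<close> to \<open>0..<q * K\<close>;
    the two end terms agree by periodicity.\<close>
  have "?h 0 + (\<Sum>n=1..q * K. ?h n) = (\<Sum>n<Suc (q * K). ?h n)"
    unfolding One_nat_def sum.lessThan_Suc_shift sum.atLeast1_atMost_eq by simp
  also have "\<dots> = (\<Sum>n<q * K. ?h n) + ?h 0" using h[of q 0] by simp
  finally have "(\<Sum>n=1..q * K. ?h n) = (\<Sum>n<q * K. ?h n)" by simp
  also have "\<dots> = real q * (\<Sum>n<K. ?h n)" unfolding sum_lessThan_mult h by simp
  finally show ?thesis .
qed

section \<open>Generic points\<close>

text \<open>A point at distance less than \<open>2 ^ -N\<close>, where \<open>N = m (s + 1)\<close>, from \<open>z + k / 2 ^ s\<close> follows the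
  orbit of \<open>z\<close> from time \<open>s\<close> to time \<open>N\<close>, and \<open>s / N < 1 / m\<close>.\<close>

definition shadowing_set :: "real \<Rightarrow> nat \<Rightarrow> circle set" where
  "shadowing_set z m =
    to_circle ` (\<Union>s. \<Union>k::int. ball (z + of_int k / 2 ^ s) ((1/2) ^ (m * Suc s)))"

lemma open_shadowing_set: "open (shadowing_set z m)"
  unfolding shadowing_set_def by (intro open_to_circle_image open_UN ballI open_ball)

text \<open>For fixed s, every real is within 2^-s of some z + k/2^s, so the centres are dense. The
  complement is closed and misses them.\<close>

lemma nowhere_dense_shadowing_set: "nowhere_dense (- shadowing_set z m)"
proof -
  have empty: "V = {}" if V: "open V" "V \<subseteq> - shadowing_set z m" for V
  proof (rule ccontr)
    assume "V \<noteq> {}"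
    then obtain c where "c \<in> V" by blast
    moreover obtain a where "c = to_circle a" using to_circle_surj by blast
    ultimately have a: "to_circle a \<in> V" by simp
    have "open (to_circle -` V)" using V(1) by (simp add: open_circle_def)
    moreover have "a \<in> to_circle -` V" using a by simp
    ultimately obtain e where e: "e > 0" "ball a e \<subseteq> to_circle -` V" by (rule openE)
    obtain s where s: "(1/2 :: real) ^ s < e" using real_arch_pow_inv[OF e(1), of "1/2"] by auto
    define k where "k = \<lfloor>2 ^ s * (a - z)\<rfloor>"
    define y where "y = z + of_int k / 2 ^ s"
    have "2 ^ s * (a - y) = 2 ^ s * (a - z) - of_int k" by (simp add: y_def field_simps)
    then have "\<bar>2 ^ s * (a - y)\<bar> \<le> 1" unfolding k_def by linarith
    then have "2 ^ s * \<bar>a - y\<bar> \<le> 1" by (simp add: abs_mult)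
    then have "\<bar>a - y\<bar> \<le> (1/2) ^ s" by (simp add: power_divide pos_le_divide_eq mult.commute)
    then have "y \<in> ball a e" using s by (simp add: dist_real_def)
    then have "to_circle y \<in> V" using e(2) by blast
    moreover have "y \<in> ball (z + of_int k / 2 ^ s) ((1/2) ^ (m * Suc s))" by (simp add: y_def)
    then have "to_circle y \<in> shadowing_set z m" unfolding shadowing_set_def by blast
    ultimately show False using V by blast
  qed
  have "interior (- shadowing_set z m) = {}"
    by (rule empty[OF open_interior interior_subset])
  then show ?thesis
    using open_shadowing_set by (simp add: nowhere_dense_def closed_Compl closure_closed)
qed

section \<open>Meager sets and generic properties\<close>

lemma meager_subset:
  assumes "countable \<F>" "\<And>A. A \<in> \<F> \<Longrightarrow> nowhere_dense A" "S \<subseteq> \<Union>\<F>"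
  shows "meager S"
  unfolding meager_def
\<comment> \<open>\<open>meager\<close> asks for an exact union, so the members of the family are
  cut down to \<open>S\<close>.\<close>
proof (intro exI[of _ "(\<lambda>A. A \<inter> S) ` \<F>"] conjI ballI)
  fix A' assume "A' \<in> (\<lambda>A. A \<inter> S) ` \<F>"
  then obtain A where A: "A \<in> \<F>" "A' \<subseteq> A" by auto
  then have "interior (closure A') \<subseteq> interior (closure A)"
    by (intro interior_mono closure_mono)
  with assms(2)[OF A(1)] show "nowhere_dense A'" by (auto simp: nowhere_dense_def)
next
  show "countable ((\<lambda>A. A \<inter> S) ` \<F>)" using assms(1) by (rule countable_image)
  show "S = \<Union> ((\<lambda>A. A \<inter> S) ` \<F>)" using assms(3) by blast
qed

lemma generic_mono:
  assumes "generic P" "\<And>\<alpha>. P \<alpha> \<Longrightarrow> Q \<alpha>"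
  shows "generic Q"
proof -
  obtain \<F> where F: "countable \<F>" "\<forall>A\<in>\<F>. nowhere_dense A" "- {\<alpha>. P \<alpha>} = \<Union>\<F>"
    using assms(1) by (auto simp: generic_def residual_def meager_def)
  then have "- {\<alpha>. Q \<alpha>} \<subseteq> \<Union>\<F>" using assms(2) by blast
  with F show ?thesis unfolding generic_def residual_def by (intro meager_subset) auto
qed

lemma generic_conj:
  assumes "generic P" "generic Q"
  shows "generic (\<lambda>\<alpha>. P \<alpha> \<and> Q \<alpha>)"
proof -
  obtain \<F> where F: "countable \<F>" "\<forall>A\<in>\<F>. nowhere_dense A" "- {\<alpha>. P \<alpha>} = \<Union>\<F>"
    using assms(1) by (auto simp: generic_def residual_def meager_def)
  obtain \<G> where G: "countable \<G>" "\<forall>A\<in>\<G>. nowhere_dense A" "- {\<alpha>. Q \<alpha>} = \<Union>\<G>"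
    using assms(2) by (auto simp: generic_def residual_def meager_def)
  have "- {\<alpha>. P \<alpha> \<and> Q \<alpha>} \<subseteq> \<Union>(\<F> \<union> \<G>)" using F(3) G(3) by blast
  then show ?thesis
    unfolding generic_def residual_def using F G by (intro meager_subset[of "\<F> \<union> \<G>"]) auto
qed

text \<open>Only countably many pairs of a rational \<open>z\<close> and an \<open>m\<close>
  occur.\<close>

lemma generic_shadowing_set: "generic (\<lambda>\<alpha>. \<forall>z\<in>\<rat>. \<forall>m. \<alpha> \<in> shadowing_set z m)"
  unfolding generic_def residual_def
proof (rule meager_subset)
  show "countable ((\<lambda>(z, m). - shadowing_set z m) ` (\<rat> \<times> UNIV))"
    using countable_rat by (intro countable_image countable_SIGMA) auto
  show "- {\<alpha>. \<forall>z\<in>\<rat>. \<forall>m. \<alpha> \<in> shadowing_set z m}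
      \<subseteq> \<Union> ((\<lambda>(z, m). - shadowing_set z m) ` (\<rat> \<times> UNIV))" by blast
  fix A assume "A \<in> (\<lambda>(z, m). - shadowing_set z m) ` (\<rat> \<times> UNIV)"
  then obtain z m where "A = - shadowing_set z m" by (elim imageE) (simp split: prod.splits)
  then show "nowhere_dense A" using nowhere_dense_shadowing_set by simp
qed

text \<open>Here \<open>q\<close> is s + 1 for the dyadic level s of the centre near \<alpha>. Times
  before s cost at most \<open>2 * B\<close> each; from s on the distance to the orbit of
  \<open>z\<close> is at most 2^(n-N), which sums to a constant. The length is a multiple of
  \<open>m\<close>, so that it can be made to consist of whole periods.\<close>

lemma shadowing_set_sum_approx:
  assumes \<alpha>: "\<alpha> \<in> shadowing_set z m"
    and mod: "\<And>f x y. f \<in> F \<Longrightarrow> \<bar>f (to_circle x) - f (to_circle y)\<bar> \<le> \<eta> + C * \<bar>x - y\<bar>"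
    and B: "\<And>f x. f \<in> F \<Longrightarrow> \<bar>f x\<bar> \<le> B" and pos: "C \<ge> 0" "\<eta> \<ge> 0" "B \<ge> 0"
  shows "\<exists>q\<ge>1. \<forall>f\<in>F. \<bar>(\<Sum>n=1..m * q. f (mult_circle (2 ^ n) \<alpha>)) -
    (\<Sum>n=1..m * q. f (mult_circle (2 ^ n) (to_circle z)))\<bar> \<le> real (m * q) * \<eta> + 2 * C + 2 * B * real q"
proof -
  obtain s and k :: int and a where
    a: "\<bar>a - (z + of_int k / 2 ^ s)\<bar> < (1/2) ^ (m * Suc s)" "\<alpha> = to_circle a"
    using \<alpha> by (auto simp: shadowing_set_def dist_real_def abs_minus_commute)
  define N where "N = m * Suc s"
  define w where "w = z + of_int k / 2 ^ s"
  have "\<bar>(\<Sum>n=1..N. f (mult_circle (2 ^ n) \<alpha>)) - (\<Sum>n=1..N. f (mult_circle (2 ^ n) (to_circle z)))\<bar>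
     \<le> real N * \<eta> + 2 * C + 2 * B * real (Suc s)" if f: "f \<in> F" for f
  proof -
    let ?d = "\<lambda>n. \<bar>f (mult_circle (2 ^ n) \<alpha>) - f (mult_circle (2 ^ n) (to_circle z))\<bar>"
    have d: "?d n \<le> (if n < s then 2 * B else 0) + (\<eta> + C * (2 ^ n * (1/2) ^ N))" for n
    proof (cases "n < s")
      case True
      have "?d n \<le> 2 * B"
        using B[OF f, of "mult_circle (2 ^ n) \<alpha>"] B[OF f, of "mult_circle (2 ^ n) (to_circle z)"]
        by linarith
      moreover have "\<eta> + C * (2 ^ n * (1/2) ^ N) \<ge> 0" using pos by simp
      ultimately show ?thesis using True by simp
    next
      case False
      \<comment> \<open>From time s on, the dyadic offset of \<open>w\<close> has become an
        integer.\<close>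
      then have "(2::real) ^ n = 2 ^ (n - s) * 2 ^ s" by (simp flip: power_add)
      then have "2 ^ n * w = 2 ^ n * z + of_int (2 ^ (n - s) * k)"
        by (simp add: w_def distrib_left)
      then have "to_circle (2 ^ n * w) = to_circle (2 ^ n * z)" by (simp only: to_circle_add_of_int)
      then have "?d n = \<bar>f (to_circle (2 ^ n * a)) - f (to_circle (2 ^ n * w))\<bar>"
        by (simp add: a(2))
      also have "\<dots> \<le> \<eta> + C * \<bar>2 ^ n * a - 2 ^ n * w\<bar>" by (rule mod[OF f])
      also have "\<bar>2 ^ n * a - 2 ^ n * w\<bar> = 2 ^ n * \<bar>a - w\<bar>"
        by (simp add: right_diff_distrib[symmetric] abs_mult)
      also have "\<eta> + C * (2 ^ n * \<bar>a - w\<bar>) \<le> \<eta> + C * (2 ^ n * (1/2) ^ N)"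
        using a(1) pos by (intro add_left_mono mult_left_mono) (auto simp: w_def N_def)
      finally show ?thesis using False by simp
    qed
    have "\<bar>(\<Sum>n=1..N. f (mult_circle (2 ^ n) \<alpha>)) - (\<Sum>n=1..N. f (mult_circle (2 ^ n) (to_circle z)))\<bar>
        \<le> (\<Sum>n=1..N. ?d n)"
      unfolding sum_subtractf[symmetric] by (rule sum_abs)
    also have "\<dots> \<le> (\<Sum>n=1..N. (if n < s then 2 * B else 0) + (\<eta> + C * (2 ^ n * (1/2) ^ N)))"
      by (intro sum_mono d)
    also have "\<dots> = (\<Sum>n=1..N. if n < s then 2 * B else 0) + real N * \<eta> + C * (1/2) ^ N * (\<Sum>n=1..N. 2 ^ n)"
      by (simp add: sum.distrib sum_distrib_left mult_ac)
    also have "\<dots> \<le> 2 * B * real (Suc s) + real N * \<eta> + C * (1/2) ^ N * (2 * 2 ^ N)"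
    proof (intro add_mono mult_left_mono order_refl)
      have "(\<Sum>n=1..N. if n < s then 2 * B else 0) = (\<Sum>n\<in>{1..N} \<inter> {..<s}. 2 * B)"
        by (simp add: sum.If_cases lessThan_def)
      also have "\<dots> \<le> (\<Sum>n<s. 2 * B)" using pos by (intro sum_mono2) auto
      also have "\<dots> \<le> 2 * B * real (Suc s)" using pos by (simp add: algebra_simps)
      finally show "(\<Sum>n=1..N. if n < s then 2 * B else 0) \<le> 2 * B * real (Suc s)" .
      have "(\<Sum>n=1..N. 2 ^ n :: real) = 2 * (\<Sum>n<N. 2 ^ n)"
        unfolding One_nat_def sum.atLeast1_atMost_eq by (simp add: sum_distrib_left)
      then show "(\<Sum>n=1..N. 2 ^ n :: real) \<le> 2 * 2 ^ N" using sum_two_power_le[of N] by simp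
    qed (use pos in \<open>auto intro!: mult_nonneg_nonneg\<close>)
    also have "\<dots> = real N * \<eta> + 2 * C + 2 * B * real (Suc s)" by (simp add: power_divide)
    finally show ?thesis .
  qed
  then show ?thesis unfolding N_def by (intro exI[of _ "Suc s"]) simp
qed

text \<open>\<alpha> follows a periodic orbit close to \<mu> for a time \<open>N\<close> so long
  that the initial stretch does not count.\<close>

lemma invariant_in_limit_measures:
  assumes \<alpha>: "\<forall>z\<in>\<rat>. \<forall>m. \<alpha> \<in> shadowing_set z m"
    and \<mu>: "\<mu> \<in> borel_prob_measures" "invariant_under (mult_circle 2) \<mu>"
  shows "\<mu> \<in> limit_measures (mult_seq (\<lambda>k. 2 ^ k) \<alpha>)"
  unfolding limit_measures_iff
proof (intro conjI allI impI)
  fix F :: "(circle \<Rightarrow> real) set" and \<epsilon> :: real and N0 :: nat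
  assume F: "finite F" "F \<subseteq> bcontfun" and \<epsilon>: "\<epsilon> > 0"
  have \<epsilon>4: "\<epsilon> / 4 > 0" using \<epsilon> by simp
  obtain z K where z: "z \<in> \<rat>" "K \<ge> 1" "mult_circle (2 ^ K) (to_circle z) = to_circle z"
    and zK: "\<And>f. f \<in> F \<Longrightarrow>
      \<bar>(\<Sum>n<K. f (mult_circle (2 ^ n) (to_circle z))) - real K * (\<integral>x. f x \<partial>\<mu>)\<bar> < real K * (\<epsilon> / 4)"
    using periodic_orbit_approx[OF \<mu> F \<epsilon>4] by blast
  obtain C where C: "C \<ge> 0" and mod: "\<And>f x y. f \<in> F \<Longrightarrow>
      \<bar>f (to_circle x) - f (to_circle y)\<bar> \<le> \<epsilon> / 4 + C * \<bar>x - y\<bar>"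
    using continuous_modulus_circle_finite[OF F \<epsilon>4] by blast
  obtain B where B: "B \<ge> 0" "\<And>f x. f \<in> F \<Longrightarrow> \<bar>f x\<bar> \<le> B"
    using bcontfun_finite_bound[OF F] by blast
  \<comment> \<open>Makes the errors \<open>2 * C\<close> and \<open>2 * B * q\<close> together at
    most \<open>real N * (\<epsilon> / 4)\<close>.\<close>
  obtain m0 :: nat where m0: "real m0 > (2 * C + 2 * B) / (\<epsilon> / 4)" using reals_Archimedean2 by blast
  define m where "m = max (max m0 N0) 1"
  have "(2 * C + 2 * B) / (\<epsilon> / 4) \<le> real m" using m0 by (simp add: m_def)
  then have m: "2 * C + 2 * B \<le> real m * (\<epsilon> / 4)" using \<epsilon>4 by (simp only: pos_divide_le_eq)
  \<comment> \<open>The factor \<open>K\<close> makes \<open>N\<close> a multiple of the period; the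
    factor \<open>m\<close> makes it large.\<close>
  have "\<alpha> \<in> shadowing_set z (K * m)" using \<alpha> z(1) by blast
  from shadowing_set_sum_approx[where F = F and B = B and C = C and \<eta> = "\<epsilon> / 4", OF this]
  have "\<exists>q\<ge>1. \<forall>f\<in>F. \<bar>(\<Sum>n=1..K * m * q. f (mult_circle (2 ^ n) \<alpha>)) -
      (\<Sum>n=1..K * m * q. f (mult_circle (2 ^ n) (to_circle z)))\<bar>
        \<le> real (K * m * q) * (\<epsilon> / 4) + 2 * C + 2 * B * real q"
    using mod B C less_imp_le[OF \<epsilon>4] by blast
  then obtain q where q: "q \<ge> 1" and
    sum: "\<And>f. f \<in> F \<Longrightarrow> \<bar>(\<Sum>n=1..K * m * q. f (mult_circle (2 ^ n) \<alpha>)) -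
      (\<Sum>n=1..K * m * q. f (mult_circle (2 ^ n) (to_circle z)))\<bar>
        \<le> real (K * m * q) * (\<epsilon> / 4) + 2 * C + 2 * B * real q" by blast
  define N where "N = K * m * q"
  have "m \<ge> N0" "m \<ge> 1" by (auto simp: m_def)
  moreover have "m \<le> N" unfolding N_def using z(2) q by (simp add: mult.assoc)
  ultimately have N: "N \<ge> N0" "N \<ge> 1" by auto
  have "\<bar>(\<Sum>n=1..N. f (mult_circle (2 ^ n) \<alpha>)) / real N - (\<integral>y. f y \<partial>\<mu>)\<bar> < \<epsilon>" if f: "f \<in> F" for f
  proof -
    let ?I = "\<integral>y. f y \<partial>\<mu>"
    have Nq: "N = (m * q) * K" by (simp add: N_def)
    have "(\<Sum>n=1..N. f (mult_circle (2 ^ n) (to_circle z))) - real N * ?I =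
        real (m * q) * ((\<Sum>n<K. f (mult_circle (2 ^ n) (to_circle z))) - real K * ?I)"
      unfolding Nq periodic_orbit_sum[OF z(3)] by (simp add: right_diff_distrib)
    then have "\<bar>(\<Sum>n=1..N. f (mult_circle (2 ^ n) (to_circle z))) - real N * ?I\<bar> =
        real (m * q) * \<bar>(\<Sum>n<K. f (mult_circle (2 ^ n) (to_circle z))) - real K * ?I\<bar>"
      by (simp add: abs_mult)
    also have "\<dots> \<le> real (m * q) * (real K * (\<epsilon> / 4))"
      using zK[OF f] by (intro mult_left_mono) auto
    also have "\<dots> = real N * (\<epsilon> / 4)" by (simp add: Nq)
    finally have 1: "\<bar>(\<Sum>n=1..N. f (mult_circle (2 ^ n) (to_circle z))) - real N * ?I\<bar> \<le> real N * (\<epsilon> / 4)" .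
    have "2 * C \<le> 2 * C * real q" using C q by (simp add: mult_le_cancel_left1)
    then have "2 * C + 2 * B * real q \<le> (2 * C + 2 * B) * real q" by (simp add: distrib_right)
    also have "\<dots> \<le> (real m * (\<epsilon> / 4)) * real q" using m by (intro mult_right_mono) auto
    also have "\<dots> = 1 * (real (m * q) * (\<epsilon> / 4))" by simp
    also have "\<dots> \<le> real K * (real (m * q) * (\<epsilon> / 4))"
      using z(2) \<epsilon> by (intro mult_right_mono) auto
    also have "\<dots> = real N * (\<epsilon> / 4)" by (simp add: Nq)
    finally have 2: "2 * C + 2 * B * real q \<le> real N * (\<epsilon> / 4)" .
    have Ne: "real N * (\<epsilon> / 4) > 0" "real N * \<epsilon> = 4 * (real N * (\<epsilon> / 4))" using N \<epsilon> by simp_all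
    have "\<bar>(\<Sum>n=1..N. f (mult_circle (2 ^ n) \<alpha>)) - real N * ?I\<bar> < real N * \<epsilon>"
      \<comment> \<open>Three quarters of \<open>real N * \<epsilon>\<close> are spent: modulus of
        continuity, initial stretch with the geometric sum, and distance of the periodic orbit from
        \<mu>.\<close>
      using sum[OF f, folded N_def] 1 2 Ne by linarith
    moreover have "(\<Sum>n=1..N. f (mult_circle (2 ^ n) \<alpha>)) / real N - ?I =
        ((\<Sum>n=1..N. f (mult_circle (2 ^ n) \<alpha>)) - real N * ?I) / real N"
      using N by (simp add: diff_divide_distrib)
    ultimately show ?thesis using N by (simp add: abs_divide pos_divide_less_eq mult.commute)
  qed
  then show "\<exists>N\<ge>N0. N \<ge> 1 \<and>
      (\<forall>f\<in>F. \<bar>(\<Sum>n=1..N. f (mult_seq (\<lambda>k. 2 ^ k) \<alpha> n)) / real N - (\<integral>y. f y \<partial>\<mu>)\<bar> < \<epsilon>)"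
    unfolding mult_seq_def using N by blast
qed (fact \<mu>)

lemma generic_limit_measures_doubling:
  "generic (\<lambda>\<alpha>. {\<mu> \<in> borel_prob_measures. invariant_under (mult_circle 2) \<mu>} =
    limit_measures (mult_seq (\<lambda>k. 2 ^ k) \<alpha>))"
proof (rule generic_mono[OF generic_shadowing_set])
  fix \<alpha> assume "\<forall>z\<in>\<rat>. \<forall>m. \<alpha> \<in> shadowing_set z m"
  then show "{\<mu> \<in> borel_prob_measures. invariant_under (mult_circle 2) \<mu>} =
      limit_measures (mult_seq (\<lambda>k. 2 ^ k) \<alpha>)"
    using invariant_in_limit_measures limit_measures_invariant by (auto simp: limit_measures_iff)
qed

section \<open>Translated sequences\<close>

text \<open>Baire's theorem is applied on the line, to the preimages of the closures of the nowhere
  dense sets.\<close>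

lemma generic_two_points:
  fixes P :: "circle \<Rightarrow> bool"
  assumes "generic P"
  shows "\<exists>\<alpha> \<beta>. \<alpha> \<noteq> \<beta> \<and> P \<alpha> \<and> P \<beta>"
proof -
  obtain \<F> where F: "countable \<F>" "\<forall>A\<in>\<F>. nowhere_dense A" "- {\<alpha>. P \<alpha>} = \<Union>\<F>"
    using assms by (auto simp: generic_def residual_def meager_def)
  define \<G> where "\<G> = (\<lambda>A. to_circle -` closure A) ` \<F>"
  have "euclidean interior_of \<Union>\<G> = {}"
  proof (rule Baire_category_alt)
    show "countable \<G>" using F(1) by (simp add: \<G>_def)
    fix T assume "T \<in> \<G>"
    then obtain A where A: "A \<in> \<F>" "T = to_circle -` closure A" by (auto simp: \<G>_def)
    \<comment> \<open>The quotient map is open, so interior points upstairs would give interior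
      points of \<open>closure A\<close>.\<close>
    have "to_circle ` interior T \<subseteq> interior (closure A)"
      using A(2) interior_subset[of T] by (intro interior_maximal open_to_circle_image) auto
    then have "interior T = {}" using F(2) A(1) by (auto simp: nowhere_dense_def)
    moreover have "closed T"
      unfolding A(2) by (intro closed_vimage continuous_to_circle) simp
    ultimately show "closedin euclidean T \<and> euclidean interior_of T = {}"
      by simp
  qed (simp add: completely_metrizable_space_euclidean)
  then have int: "interior (\<Union>\<G>) = {}" by simp
  have ex: "\<exists>x\<in>U. P (to_circle x)" if U: "open U" "U \<noteq> {}" for U
  proof (rule ccontr)
    assume neg: "\<not> ?thesis"
    have "U \<subseteq> \<Union>\<G>"
    proof
      fix x assume "x \<in> U"
      then have "to_circle x \<in> \<Union>\<F>" using neg F(3) by blast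
      then show "x \<in> \<Union>\<G>" unfolding \<G>_def using closure_subset by blast
    qed
    then show False using U int interior_maximal by blast
  qed
  \<comment> \<open>Disjoint intervals inside (0, 1) give points that differ modulo 1.\<close>
  obtain x where x: "x \<in> {0<..<1/2}" "P (to_circle x)" using ex[of "{0<..<1/2}"] by auto
  obtain y where y: "y \<in> {1/2<..<1}" "P (to_circle y)" using ex[of "{1/2<..<1}"] by auto
  have "y - x \<notin> \<int>"
  proof
    assume "y - x \<in> \<int>"
    then obtain k :: int where "y - x = of_int k" by (auto elim: Ints_cases)
    moreover have "0 < y - x" "y - x < 1" using x(1) y(1) by auto
    ultimately have "0 < k" "k < 1" by linarith+
    then show False by simp
  qed
  then have "to_circle y \<noteq> to_circle x" by (simp add: to_circle_eq_iff)
  with x y show ?thesis by blast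
qed

text \<open>Averages of f along the image sequence are averages of f composed with \<open>T\<close>
  along \<open>x\<close>.\<close>

lemma limit_measures_distr:
  fixes T :: "'a::topological_space \<Rightarrow> 'b::topological_space"
  assumes "\<mu> \<in> limit_measures x" "continuous_on UNIV T"
  shows "distr \<mu> borel T \<in> limit_measures (\<lambda>n. T (x n))"
  unfolding limit_measures_iff
proof (intro conjI allI impI)
  have pm: "\<mu> \<in> borel_prob_measures" using assms(1) by (simp add: limit_measures_iff)
  show "distr \<mu> borel T \<in> borel_prob_measures"
    by (rule distr_in_borel_prob_measures[OF pm assms(2)])
  fix F :: "('b \<Rightarrow> real) set" and \<epsilon> :: real and N0 :: nat
  assume F: "finite F" "F \<subseteq> bcontfun" and \<epsilon>: "\<epsilon> > 0"
  define G where "G = (\<lambda>f y. f (T y)) ` F"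
  have G: "finite G" "G \<subseteq> bcontfun" using F bcontfun_compose[OF _ assms(2)] by (auto simp: G_def)
  obtain N where N: "N \<ge> N0" "N \<ge> 1"
    "\<forall>g\<in>G. \<bar>(\<Sum>n=1..N. g (x n)) / real N - (\<integral>y. g y \<partial>\<mu>)\<bar> < \<epsilon>"
    using assms(1) G \<epsilon> unfolding limit_measures_iff by blast
  have "(\<integral>y. f y \<partial>distr \<mu> borel T) = (\<integral>y. f (T y) \<partial>\<mu>)" if "f \<in> F" for f
    using integral_distr_bcontfun[OF pm assms(2)] F that by blast
  then show "\<exists>N\<ge>N0. N \<ge> 1 \<and>
      (\<forall>f\<in>F. \<bar>(\<Sum>n=1..N. f (T (x n))) / real N - (\<integral>y. f y \<partial>distr \<mu> borel T)\<bar> < \<epsilon>)"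
    using N by (intro exI[of _ N]) (simp add: G_def)
qed

lemma return_in_limit_measures:
  fixes T :: "'a::topological_space \<Rightarrow> 'b::topological_space"
  assumes "return borel c \<in> limit_measures x" "continuous_on UNIV T"
  shows "return borel (T c) \<in> limit_measures (\<lambda>n. T (x n))"
proof -
  have "distr (return borel c) borel T = return borel (T c)"
    using borel_measurable_continuous_onI[OF assms(2)] by (intro distr_return) auto
  then show ?thesis using limit_measures_distr[OF assms] by simp
qed

text \<open>Attains its maximum 1 only at \<open>to_circle 0\<close>, so its translates separate
  points.\<close>

lift_definition circle_cos :: "circle \<Rightarrow> real" is "\<lambda>x. cos (2 * pi * x)"
proof -
  fix x y :: real assume "x - y \<in> \<int>"
  then obtain k :: int where "x - y = of_int k" by (auto elim: Ints_cases)
  then have "2 * pi * x = 2 * pi * y + 2 * pi * of_int k" by (simp flip: distrib_left)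
  then show "cos (2 * pi * x) = cos (2 * pi * y)" by (simp add: cos_add)
qed

lemma circle_cos_to_circle [simp]: "circle_cos (to_circle x) = cos (2 * pi * x)"
  by (rule circle_cos.abs_eq)

lemma return_in_borel_prob_measures: "return borel c \<in> borel_prob_measures"
  by (auto simp: borel_prob_measures_def intro: prob_space_return)

text \<open>Test invariance with the translate of \<open>circle_cos\<close> that peaks only at
  \<open>c\<close>: its value at \<open>T c\<close> must again be 1.\<close>

lemma invariant_under_return_fixed:
  fixes c :: circle
  assumes "invariant_under T (return borel c)" "continuous_on UNIV T"
  shows "T c = c"
proof -
  obtain a where a: "c = to_circle a" using to_circle_surj by blast
  obtain b where b: "T c = to_circle b" using to_circle_surj by blast
  define f where "f x = circle_cos (add_circle (to_circle (- a)) x)" for x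
  have f: "f (to_circle x) = cos (2 * pi * (x - a))" for x by (simp add: f_def)
  have "continuous_on UNIV f"
    by (subst continuous_on_circle_iff) (auto simp: f intro!: continuous_intros)
  moreover have "\<bar>f x\<bar> \<le> 1" for x using to_circle_surj[of x] by (auto simp: f)
  ultimately have fb: "f \<in> bcontfun" by (auto simp: bcontfun_def bounded_iff)
  have "(\<integral>x. f (T x) \<partial>return borel c) = (\<integral>x. f x \<partial>return borel c)"
    by (rule integral_invariant_under[OF return_in_borel_prob_measures assms(2,1) fb])
  then have "f (T c) = f c"
    using bcontfun_measurable[OF fb] bcontfun_measurable[OF bcontfun_compose[OF fb assms(2)]]
    by (simp add: integral_return)
  then have "cos (2 * pi * (b - a)) = 1" unfolding a by (simp add: b[unfolded a] f)
  then obtain k :: int where "2 * pi * (b - a) = of_int k * 2 * pi"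
    using cos_one_2pi_int by blast
  then have "b - a = of_int k" by simp
  then show ?thesis unfolding b unfolding a to_circle_eq_iff by simp
qed

lemma mult_circle_Suc: "mult_circle (n + 1) c = add_circle c (mult_circle n c)"
  using to_circle_surj[of c] by (auto simp: algebra_simps)

lemma return_zero_invariant: "invariant_under (mult_circle n) (return borel (to_circle 0))"
proof -
  have "mult_circle n -` A \<in> sets borel" if "A \<in> sets borel" for A
    using measurable_sets_borel[OF borel_measurable_continuous_onI[OF continuous_mult_circle] that] .
  then show ?thesis by (auto simp: invariant_under_def indicator_def)
qed

text \<open>Two distinct generic points \<alpha> and \<beta> would share all limit measures, among
  them the Dirac measure at \<beta>. Translated back by \<alpha>, it would be an invariant Dirac
  measure away from 0.\<close>

lemma no_generic_limit_measures_translated: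
  "\<not> generic (\<lambda>\<alpha>. M' = limit_measures (mult_seq (\<lambda>k. 2 ^ k + 1) \<alpha>))"
proof
  assume "generic (\<lambda>\<alpha>. M' = limit_measures (mult_seq (\<lambda>k. 2 ^ k + 1) \<alpha>))"
  from generic_two_points[OF generic_conj[OF this generic_limit_measures_doubling]]
  obtain \<alpha> \<beta> where ne: "\<alpha> \<noteq> \<beta>"
    and eq: "limit_measures (mult_seq (\<lambda>k. 2 ^ k + 1) \<beta>) = limit_measures (mult_seq (\<lambda>k. 2 ^ k + 1) \<alpha>)"
    and \<alpha>: "{\<mu> \<in> borel_prob_measures. invariant_under (mult_circle 2) \<mu>} =
      limit_measures (mult_seq (\<lambda>k. 2 ^ k) \<alpha>)"
    and \<beta>: "{\<mu> \<in> borel_prob_measures. invariant_under (mult_circle 2) \<mu>} =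
      limit_measures (mult_seq (\<lambda>k. 2 ^ k) \<beta>)"
    by auto
  obtain a b where ab: "\<alpha> = to_circle a" "\<beta> = to_circle b" using to_circle_surj by metis
  \<comment> \<open>The Dirac measure at the fixed point 0 is invariant; translation by \<beta>
    moves it to \<beta>.\<close>
  have "return borel (to_circle 0) \<in> limit_measures (mult_seq (\<lambda>k. 2 ^ k) \<beta>)"
    using \<beta> return_in_borel_prob_measures return_zero_invariant by blast
  from return_in_limit_measures[OF this continuous_add_circle[of \<beta>]]
  have "return borel \<beta> \<in> limit_measures (mult_seq (\<lambda>k. 2 ^ k + 1) \<beta>)"
    by (simp only: mult_seq_def mult_circle_Suc) (simp add: ab)
  then have "return borel \<beta> \<in> limit_measures (mult_seq (\<lambda>k. 2 ^ k + 1) \<alpha>)" by (simp only: eq)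
  \<comment> \<open>Subtracting \<alpha> turns (2^k + 1) \<alpha> back into 2^k \<alpha>.\<close>
  from return_in_limit_measures[OF this continuous_add_circle[of "to_circle (- a)"]]
  have "return borel (to_circle (b - a)) \<in> limit_measures (mult_seq (\<lambda>k. 2 ^ k) \<alpha>)"
    unfolding mult_seq_def ab by (simp add: algebra_simps)
  then have "invariant_under (mult_circle 2) (return borel (to_circle (b - a)))" using \<alpha> by blast
  from invariant_under_return_fixed[OF this continuous_mult_circle]
  \<comment> \<open>A point that equals its double modulo 1 is 0 modulo 1.\<close>
  have "b - a \<in> \<int>" by (simp add: to_circle_eq_iff)
  then show False using ne ab by (metis to_circle_eq_iff)
qed

theorem theorem2p8:
  shows "(\<exists>M :: circle measure set. M \<subseteq> borel_prob_measures
            \<and> generic (\<lambda>\<alpha> :: circle. M = limit_measures (mult_seq (\<lambda>k. 2 ^ k) \<alpha>))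
            \<and> M = {\<mu> \<in> borel_prob_measures. invariant_under (mult_circle 2) \<mu>})
       \<and> \<not> (\<exists>M' :: circle measure set. M' \<subseteq> borel_prob_measures
            \<and> generic (\<lambda>\<alpha> :: circle. M' = limit_measures (mult_seq (\<lambda>k. 2 ^ k + 1) \<alpha>)))"
proof (intro conjI notI)
  show "\<exists>M :: circle measure set. M \<subseteq> borel_prob_measures
      \<and> generic (\<lambda>\<alpha> :: circle. M = limit_measures (mult_seq (\<lambda>k. 2 ^ k) \<alpha>))
      \<and> M = {\<mu> \<in> borel_prob_measures. invariant_under (mult_circle 2) \<mu>}"
    by (intro exI[of _ "{\<mu> \<in> borel_prob_measures. invariant_under (mult_circle 2) \<mu>}"] conjI
        generic_limit_measures_doubling refl) simp
qed (elim exE conjE notE[OF no_generic_limit_measures_translated])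

end
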